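(* The following hold. (1) If $\overline M\ge\overline M^\star$, then linearly damping the deviation from the cell average just enough to enforce nonnegativity of the retentional $\overline{\mathcal R}^{\overline M}:=\overline M\,\overline{\mathcal C}-\overline{\mathcal B}$ retains order-$k$ local accuracy (as defined in the context). (2) Any $U\in\mathcal V_K^+$ and any correct boundary-weighted quadrature rule $\overline{\mathcal C}(U)=\sum_{\mathbf x\in X}w_{\mathbf x}U(\mathbf x)+\overline W\,\overline{\mathcal B}(U)$ give a bracket $\widehat{\overline{\mathcal B}}(U)\le\overline M^\star\le\overline W^{-1}$. (3) There exist an optimizer $U^\star\in\mathcal V_K^+$ and an optimal (correct) boundary-weighted quadrature rule, with boundary weight $\overline W$, such that the bracket is an equality: $\widehat{\overline{\mathcal B}}(U^\star)=\overline M^\star=\overline W^{-1}$. (4) For a correct boundary-weighted quadrature rule with point set $X$ (the retentional points) and boundary weight $\overline W=\overline M^{-1}$, enforcing nonnegativity of $U\in\mathcal V$ at all points of $X$ enforces $\overline{\mathcal R}^{\overline M}(U)\ge 0$. (5) If $\overline M^\star\neq 1$ then the zero set in $K$ of any optimizer $U^\star$ is nonempty; and it must contain $X$ whenever $X$ is the point set of an optimal rule (one with $\overline W=1/\overline M^\star$). (6) All these statements continue to hold if the optimizer $U^\star$, or the quadrature rule (i.e. the retentional points $X$ and the quadrature weights $w_{\mathbf x}$), is required to be invariant under the action of the isometries of the mesh cell $K$.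
   Context: $K\subset\mathbb R^D$ is a compact mesh cell (in canonical coordinates), and $\mathcal V$ is a finite-dimensional space of polynomials containing all polynomials in $D$ variables of degree at most $k\ge 0$. $\overline{\mathcal C}(U)$ is the average of $U$ over $K$, $\overline{\mathcal B}(U)$ is the average of $U$ over $\partial K$, $\widehat{\overline{\mathcal B}}(U):=\overline{\mathcal B}(U)/\overline{\mathcal C}(U)$, $\mathcal V_K^+:=\{U\in\mathcal V:U\ge0\text{ in }K,\ \overline{\mathcal C}(U)>0\}$, and $\overline M^\star:=\sup_{U\in\mathcal V_K^+}\widehat{\overline{\mathcal B}}(U)$. An optimizer is a $U^\star\in\mathcal V_K^+$ with $\widehat{\overline{\mathcal B}}(U^\star)=\overline M^\star$. A correct boundary-weighted quadrature rule is an identity $\overline{\mathcal C}(U)=\sum_{\mathbf x\in X}w_{\mathbf x}U(\mathbf x)+\overline W\,\overline{\mathcal B}(U)$ valid for all $U\in\mathcal V$, with a set of quadrature points $X\subset K$, positive weights $w_{\mathbf x}$, and boundary weight $\overline W>0$. The isometries of $K$ are the isometries of $\mathbb R^D$ mapping $K$ to itself; they act on functions by composition and on quadrature rules by moving the points together with their weights. "Retains order-$k$ local accuracy" means: if $u_\delta:K\to[0,\infty)$ is a family of nonnegative functions and $U_\delta\in\mathcal V$ has nonnegative cell average with $\sup_K|U_\delta-u_\delta|=O(\delta^{k+1})$ as $\delta\to0$, and $\theta_\delta$ is the largest $\theta\in[0,1]$ with $\overline{\mathcal R}^{\overline M}(\overline U_\delta+\theta(U_\delta-\overline U_\delta))\ge0$,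 where $\overline U_\delta:=\overline{\mathcal C}(U_\delta)$, then $\sup_K|\overline U_\delta+\theta_\delta(U_\delta-\overline U_\delta)-u_\delta|=O(\delta^{k+1})$.
   Formalization: In (6), existence of an invariant optimizer or rule is claimed only when the polynomial space is preserved by the isometries of the cell, and existence of an invariant rule only when the cell has finitely many isometries (automatic for polytopes); both fail in general otherwise. *)

theory Defs
  imports "HOL-Analysis.Analysis" "HOL-Library.Function_Algebras"
begin

section \<open>Surface measure\<close>

text \<open>
  The \<open>d\<close>-dimensional Hausdorff measure, normalised so that it agrees with Lebesgue measure on
  \<open>d\<close>-dimensional subspaces.  Empty covering sets are given weight 0 separately because
  \<open>0 ^ 0 = 1\<close>; thus \<open>d = 0\<close> yields counting measure, as needed for the boundary of an interval.
\<close>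

definition hausdorff_weight :: "nat \<Rightarrow> 'a::metric_space set \<Rightarrow> ennreal" where
  "hausdorff_weight d C =
     (if C = {} then 0 else ennreal (unit_ball_vol (real d) * (diameter C / 2) ^ d))"

definition hausdorff_pre :: "nat \<Rightarrow> real \<Rightarrow> 'a::metric_space set \<Rightarrow> ennreal" where
  "hausdorff_pre d e A =
     (INF C \<in> {C :: nat \<Rightarrow> 'a set. A \<subseteq> (\<Union>i. C i) \<and> (\<forall>i. bounded (C i) \<and> diameter (C i) \<le> e)}.
        \<Sum>i. hausdorff_weight d (C i))"

definition hausdorff_outer :: "nat \<Rightarrow> 'a::metric_space set \<Rightarrow> ennreal" where
  "hausdorff_outer d A = (SUP e \<in> {0<..}. hausdorff_pre d e A)"

definition hausdorff_measure :: "nat \<Rightarrow> 'a::metric_space measure" where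
  "hausdorff_measure d = measure_of UNIV (sets borel) (hausdorff_outer d)"

lemma ennreal_suminf_tail:
  fixes f :: "nat \<Rightarrow> ennreal"
  assumes "(\<Sum>j. f j) \<noteq> top"
  shows "(\<lambda>n. \<Sum>j. f (j + n)) \<longlonglongrightarrow> 0"
proof -
  have "f j < top" for j using assms by (simp add: ennreal_suminf_lessD less_top)
  then have f: "f = (\<lambda>j. ennreal (enn2real (f j)))" by (simp add: fun_eq_iff)
  have sm: "summable (\<lambda>j. enn2real (f j))"
    using assms by (subst (asm) f) (intro summable_suminf_not_top, auto)
  then have "(\<lambda>n. ennreal (\<Sum>j. enn2real (f (j + n)))) \<longlonglongrightarrow> ennreal 0"
    by (intro tendsto_ennrealI suminf_exist_split2)
  moreover have "ennreal (\<Sum>j. enn2real (f (j + n))) = (\<Sum>j. f (j + n))" for n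
    using sm summable_ignore_initial_segment[OF sm, of n]
    by (subst suminf_ennreal2[symmetric]) (auto simp: \<open>\<And>j. f j < top\<close>)
  ultimately show ?thesis by simp
qed


lemma hausdorff_weight_empty [simp]: "hausdorff_weight d {} = 0"
  by (simp add: hausdorff_weight_def)

lemma hausdorff_pre_mono: "A \<subseteq> B \<Longrightarrow> hausdorff_pre d e A \<le> hausdorff_pre d e B"
  unfolding hausdorff_pre_def by (intro INF_superset_mono) auto

lemma hausdorff_pre_antimono: "e \<le> e' \<Longrightarrow> hausdorff_pre d e' A \<le> hausdorff_pre d e A"
  unfolding hausdorff_pre_def by (rule INF_superset_mono) (auto intro: order_trans)

lemma hausdorff_pre_le:
  "A \<subseteq> (\<Union>i. C i) \<Longrightarrow> (\<And>i. bounded (C i)) \<Longrightarrow> (\<And>i. diameter (C i) \<le> e) \<Longrightarrow>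
     hausdorff_pre d e A \<le> (\<Sum>i. hausdorff_weight d (C i))"
  unfolding hausdorff_pre_def by (intro INF_lower) auto

lemma hausdorff_pre_empty: "0 < e \<Longrightarrow> hausdorff_pre d e {} = 0"
  using hausdorff_pre_le[of "{}" "\<lambda>_. {}" e d] by simp

lemma hausdorff_pre_countably_subadditive:
  "hausdorff_pre d e (\<Union>i. A i) \<le> (\<Sum>i. hausdorff_pre d e (A i))"
proof (rule ennreal_le_epsilon)
  fix s :: real
  assume fin: "(\<Sum>i. hausdorff_pre d e (A i)) < top" and s: "0 < s"
  have "\<exists>C. A i \<subseteq> (\<Union>j. C j) \<and> (\<forall>j. bounded (C j) \<and> diameter (C j) \<le> e) \<and>
      (\<Sum>j. hausdorff_weight d (C j)) \<le> hausdorff_pre d e (A i) + ennreal (s * (1/2) ^ Suc i)" for i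
  proof -
    have "hausdorff_pre d e (A i) < top"
      using fin by (metis ennreal_suminf_lessD)
    then have "hausdorff_pre d e (A i) < hausdorff_pre d e (A i) + ennreal (s * (1/2) ^ Suc i)"
      using s by (simp add: ennreal_zero_less_mult_iff)
    then obtain C where "A i \<subseteq> (\<Union>j. C j)" "\<And>j. bounded (C j)" "\<And>j. diameter (C j) \<le> e"
        "(\<Sum>j. hausdorff_weight d (C j)) < hausdorff_pre d e (A i) + ennreal (s * (1/2) ^ Suc i)"
      unfolding hausdorff_pre_def[of d e "A i"] INF_less_iff by auto
    then show ?thesis by (intro exI[of _ C]) (auto intro: less_imp_le)
  qed
  then obtain C where C: "\<And>i. A i \<subseteq> (\<Union>j. C i j)" "\<And>i j. bounded (C i j)"
      "\<And>i j. diameter (C i j) \<le> e"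
      "\<And>i. (\<Sum>j. hausdorff_weight d (C i j)) \<le> hausdorff_pre d e (A i) + ennreal (s * (1/2) ^ Suc i)"
    by metis
  have "hausdorff_pre d e (\<Union>i. A i) \<le> (\<Sum>n. hausdorff_weight d (case_prod C (prod_decode n)))"
  proof (rule hausdorff_pre_le)
    show "(\<Union>i. A i) \<subseteq> (\<Union>n. case_prod C (prod_decode n))"
    proof
      fix x assume "x \<in> (\<Union>i. A i)"
      then obtain i j where "x \<in> C i j" using C(1) by blast
      then show "x \<in> (\<Union>n. case_prod C (prod_decode n))"
        by (intro UN_I[of "prod_encode (i, j)"]) auto
    qed
  qed (auto simp: C split: prod.split)
  also have "\<dots> = (\<Sum>i. \<Sum>j. hausdorff_weight d (C i j))"
    using suminf_ennreal_2dimen[of "\<lambda>i. \<Sum>j. hausdorff_weight d (C i j)"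
        "\<lambda>p. hausdorff_weight d (case_prod C p)"] by (simp add: o_def)
  also have "\<dots> \<le> (\<Sum>i. hausdorff_pre d e (A i) + ennreal (s * (1/2) ^ Suc i))"
    by (intro suminf_le C summableI)
  also have "\<dots> = (\<Sum>i. hausdorff_pre d e (A i)) + (\<Sum>i. ennreal (s * (1/2) ^ Suc i))"
    by (rule suminf_add[symmetric]) (auto intro: summableI)
  also have "(\<Sum>i. ennreal (s * (1/2) ^ Suc i)) = ennreal s"
    using s sums_mult[OF power_half_series, of s]
    by (subst suminf_ennreal_eq[of _ s]) auto
  finally show "hausdorff_pre d e (\<Union>i. A i) \<le> (\<Sum>i. hausdorff_pre d e (A i)) + ennreal s" .
qed

lemma hausdorff_pre_le_outer: "0 < e \<Longrightarrow> hausdorff_pre d e A \<le> hausdorff_outer d A"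
  unfolding hausdorff_outer_def by (intro SUP_upper) auto

lemma hausdorff_outer_mono: "A \<subseteq> B \<Longrightarrow> hausdorff_outer d A \<le> hausdorff_outer d B"
  unfolding hausdorff_outer_def by (intro SUP_mono) (auto intro: hausdorff_pre_mono)

lemma hausdorff_outer_empty: "hausdorff_outer d {} = 0"
proof -
  have "hausdorff_outer d ({} :: 'a set) \<le> 0"
    unfolding hausdorff_outer_def by (intro SUP_least) (simp add: hausdorff_pre_empty)
  then show ?thesis by simp
qed

lemma hausdorff_outer_countably_subadditive:
  "hausdorff_outer d (\<Union>i. A i) \<le> (\<Sum>i. hausdorff_outer d (A i))"
  unfolding hausdorff_outer_def[of d "\<Union>i. A i"]
proof (rule SUP_least)
  fix e :: real assume "e \<in> {0<..}"
  then show "hausdorff_pre d e (\<Union>i. A i) \<le> (\<Sum>i. hausdorff_outer d (A i))"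
    by (intro order_trans[OF hausdorff_pre_countably_subadditive] suminf_le summableI
        hausdorff_pre_le_outer) auto
qed

lemma hausdorff_outer_measure_space: "outer_measure_space UNIV (hausdorff_outer d)"
  unfolding outer_measure_space_def positive_def increasing_def countably_subadditive_def
  by (auto simp: hausdorff_outer_empty intro: hausdorff_outer_mono
      hausdorff_outer_countably_subadditive)

lemma hausdorff_outer_Un: "hausdorff_outer d (A \<union> B) \<le> hausdorff_outer d A + hausdorff_outer d B"
proof -
  define S where "S i = (if i = 0 then A else if i = Suc 0 then B else {})" for i :: nat
  have "A \<union> B = (\<Union>i. S i)"
    by (auto simp: S_def split: if_splits)
  then have "hausdorff_outer d (A \<union> B) \<le> (\<Sum>i. hausdorff_outer d (S i))"
    by (simp add: hausdorff_outer_countably_subadditive)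
  also have "\<dots> = (\<Sum>i\<in>{0, Suc 0}. hausdorff_outer d (S i))"
    by (rule suminf_finite) (auto simp: S_def hausdorff_outer_empty)
  finally show ?thesis by (simp add: S_def)
qed

lemma hausdorff_outer_separated:
  assumes r: "0 < r" and sep: "\<And>x y. x \<in> A \<Longrightarrow> y \<in> B \<Longrightarrow> r \<le> dist x y"
  shows "hausdorff_outer d A + hausdorff_outer d B \<le> hausdorff_outer d (A \<union> B)"
proof -
  have pre: "hausdorff_pre d e A + hausdorff_pre d e B \<le> hausdorff_pre d e (A \<union> B)"
    if e: "0 < e" "e < r" for e
    unfolding hausdorff_pre_def[of d e "A \<union> B"]
  proof (rule INF_greatest)
    fix C :: "nat \<Rightarrow> 'a set"
    assume "C \<in> {C. A \<union> B \<subseteq> (\<Union>i. C i) \<and> (\<forall>i. bounded (C i) \<and> diameter (C i) \<le> e)}"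
    then have C: "A \<union> B \<subseteq> (\<Union>i. C i)" "\<And>i. bounded (C i)" "\<And>i. diameter (C i) \<le> e"
      by auto
    define CA where "CA i = (if C i \<inter> A = {} then {} else C i)" for i
    define CB where "CB i = (if C i \<inter> B = {} then {} else C i)" for i
    have "hausdorff_pre d e A \<le> (\<Sum>i. hausdorff_weight d (CA i))"
      using C e by (intro hausdorff_pre_le) (fastforce simp: CA_def)+
    moreover have "hausdorff_pre d e B \<le> (\<Sum>i. hausdorff_weight d (CB i))"
      using C e by (intro hausdorff_pre_le) (fastforce simp: CB_def)+
    moreover have "hausdorff_weight d (CA i) + hausdorff_weight d (CB i) \<le> hausdorff_weight d (C i)" for i
    proof -
      have "C i \<inter> A = {} \<or> C i \<inter> B = {}"
      proof (rule ccontr)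
        assume "\<not> ?thesis"
        then obtain x y where xy: "x \<in> C i" "x \<in> A" "y \<in> C i" "y \<in> B" by auto
        have "dist x y \<le> e"
          using diameter_bounded_bound[OF C(2) xy(1,3)] C(3)[of i] by simp
        with sep[OF xy(2,4)] e show False by simp
      qed
      then show ?thesis by (auto simp: CA_def CB_def)
    qed
    then have "(\<Sum>i. hausdorff_weight d (CA i) + hausdorff_weight d (CB i)) \<le> (\<Sum>i. hausdorff_weight d (C i))"
      by (intro suminf_le summableI)
    ultimately show "hausdorff_pre d e A + hausdorff_pre d e B \<le> (\<Sum>i. hausdorff_weight d (C i))"
      by (subst (asm) suminf_add[symmetric]) (auto intro: summableI order_trans add_mono)
  qed
  have "hausdorff_pre d e1 A + hausdorff_pre d e2 B \<le> hausdorff_outer d (A \<union> B)"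
    if "0 < e1" "0 < e2" for e1 e2
  proof -
    define e where "e = min (min e1 e2) (r / 2)"
    have e: "0 < e" "e < r" "e \<le> e1" "e \<le> e2" using r that by (auto simp: e_def)
    have "hausdorff_pre d e1 A + hausdorff_pre d e2 B \<le> hausdorff_pre d e A + hausdorff_pre d e B"
      by (intro add_mono hausdorff_pre_antimono e)
    also note pre[OF e(1,2)]
    also note hausdorff_pre_le_outer[OF e(1)]
    finally show ?thesis .
  qed
  then have "(SUP e1\<in>{0<..}. hausdorff_pre d e1 A + hausdorff_pre d e2 B) \<le> hausdorff_outer d (A \<union> B)"
    if "0 < e2" for e2
    using that by (intro SUP_least) auto
  then have "hausdorff_outer d A + hausdorff_pre d e2 B \<le> hausdorff_outer d (A \<union> B)" if "0 < e2" for e2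
    using that unfolding hausdorff_outer_def[of d A] by (subst ennreal_SUP_add_left[symmetric]) auto
  then have "(SUP e2\<in>{0<..}. hausdorff_pre d e2 B + hausdorff_outer d A) \<le> hausdorff_outer d (A \<union> B)"
    by (intro SUP_least) (auto simp: add.commute)
  then have "hausdorff_outer d B + hausdorff_outer d A \<le> hausdorff_outer d (A \<union> B)"
    unfolding hausdorff_outer_def[of d B] by (subst ennreal_SUP_add_left[symmetric]) auto
  then show ?thesis by (simp add: add.commute)
qed

lemma hausdorff_outer_UN_separated:
  assumes fin: "finite I" and r: "0 < r"
    and sep: "\<And>i j x y. i \<in> I \<Longrightarrow> j \<in> I \<Longrightarrow> i \<noteq> j \<Longrightarrow> x \<in> S i \<Longrightarrow> y \<in> S j \<Longrightarrow> r \<le> dist x y"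
  shows "(\<Sum>i\<in>I. hausdorff_outer d (S i)) \<le> hausdorff_outer d (\<Union>i\<in>I. S i)"
  using fin sep
proof (induction I rule: finite_induct)
  case empty
  then show ?case by simp
next
  case (insert a I)
  have "(\<Sum>i\<in>I. hausdorff_outer d (S i)) \<le> hausdorff_outer d (\<Union>i\<in>I. S i)"
    using insert.prems by (intro insert.IH) blast
  moreover have "hausdorff_outer d (S a) + hausdorff_outer d (\<Union>i\<in>I. S i) \<le>
      hausdorff_outer d (S a \<union> (\<Union>i\<in>I. S i))"
  proof (rule hausdorff_outer_separated[OF r])
    fix x y assume "x \<in> S a" "y \<in> (\<Union>i\<in>I. S i)"
    then show "r \<le> dist x y" using insert.prems insert.hyps by (metis UN_E insertCI)
  qed
  ultimately show ?case
    using insert.hyps by (simp add: order_trans[OF add_left_mono])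
qed

lemma closed_hausdorff_caratheodory:
  fixes F :: "'a::metric_space set"
  assumes F: "closed F"
  shows "hausdorff_outer d (A \<inter> F) + hausdorff_outer d (A - F) \<le> hausdorff_outer d A"
proof (cases "hausdorff_outer d A = \<infinity> \<or> F = {}")
  case True
  then show ?thesis by (auto simp: hausdorff_outer_empty)
next
  case False
  then have fin: "hausdorff_outer d A < \<infinity>" and ne: "F \<noteq> {}" by (auto simp: less_top)
  define S where "S n = {x \<in> A. 1 / (real n + 1) \<le> infdist x F}" for n
  define R where "R n = {x \<in> A. 1 / (real n + 2) \<le> infdist x F \<and> infdist x F < 1 / (real n + 1)}" for n
  have sub: "dist x y \<ge> infdist x F - infdist y F" for x y
    using infdist_triangle[of x F y] by simp
  have half: "(\<Sum>j<n. hausdorff_outer d (R (2 * j + c))) \<le> hausdorff_outer d A" for n c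
  proof -
    define r where "r = 1 / (real (2 * n + c) + 1) - 1 / (real (2 * n + c) + 2)"
    have gap: "r \<le> 1 / (real (2 * i + c) + 2) - 1 / (real (2 * j + c) + 1)"
      if "i < j" "j < n" for i j
    proof -
      have "real (2 * i + c) + 2 \<le> real (2 * j + c)" using that by linarith
      then have "1 / (real (2 * i + c) + 2) \<ge> 1 / real (2 * j + c)"
        using that by (intro divide_left_mono) auto
      moreover have "1 / real (2 * j + c) - 1 / (real (2 * j + c) + 1) = 1 / (real (2 * j + c) * (real (2 * j + c) + 1))"
        using that by (simp add: field_simps)
      moreover have "r = 1 / ((real (2 * n + c) + 1) * (real (2 * n + c) + 2))"
        by (simp add: r_def field_simps)
      moreover have "1 / ((real (2 * n + c) + 1) * (real (2 * n + c) + 2)) \<le>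
          1 / (real (2 * j + c) * (real (2 * j + c) + 1))"
        using that by (intro divide_left_mono mult_mono) auto
      ultimately show ?thesis by linarith
    qed
    have "(\<Sum>j<n. hausdorff_outer d (R (2 * j + c))) \<le> hausdorff_outer d (\<Union>j<n. R (2 * j + c))"
    proof (rule hausdorff_outer_UN_separated)
      have "1 / (real (2 * n + c) + 2) < 1 / (real (2 * n + c) + 1)"
        by (intro divide_strict_left_mono) auto
      then show "0 < r" by (simp add: r_def)
      fix i j x y
      assume ij: "i \<in> {..<n}" "j \<in> {..<n}" "i \<noteq> j" and xy: "x \<in> R (2 * i + c)" "y \<in> R (2 * j + c)"
      show "r \<le> dist x y"
      proof (cases "i < j")
        case True
        then show ?thesis using gap[of i j] ij xy sub[of x y] by (simp add: R_def)
      next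
        case False
        then show ?thesis using gap[of j i] ij xy sub[of y x] by (simp add: R_def dist_commute)
      qed
    qed simp
    also have "\<dots> \<le> hausdorff_outer d A" by (intro hausdorff_outer_mono) (auto simp: R_def)
    finally show ?thesis .
  qed
  have "(\<Sum>j<n. hausdorff_outer d (R j)) \<le> 2 * hausdorff_outer d A" for n
  proof -
    have "(\<Sum>j<n. hausdorff_outer d (R j)) \<le> (\<Sum>j<2*n. hausdorff_outer d (R j))"
      by (intro sum_mono2) auto
    also have "\<dots> = (\<Sum>j<n. hausdorff_outer d (R (2 * j + 0))) + (\<Sum>j<n. hausdorff_outer d (R (2 * j + 1)))"
      by (induction n) (auto simp: algebra_simps)
    also have "\<dots> \<le> hausdorff_outer d A + hausdorff_outer d A"
      by (intro add_mono half)
    finally show ?thesis by (simp add: mult_2)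
  qed
  then have "(\<Sum>j. hausdorff_outer d (R j)) \<le> 2 * hausdorff_outer d A"
    by (intro suminf_le_const summableI)
  also have "\<dots> < top" using fin by (simp add: ennreal_mult_less_top)
  finally have Rfin: "(\<Sum>j. hausdorff_outer d (R j)) \<noteq> top" by simp
  have tail: "(\<lambda>n. \<Sum>j. hausdorff_outer d (R (j + n))) \<longlonglongrightarrow> 0"
    by (rule ennreal_suminf_tail[OF Rfin])
  have "hausdorff_outer d (A \<inter> F) + hausdorff_outer d (A - F) \<le>
      hausdorff_outer d A + (\<Sum>j. hausdorff_outer d (R (j + n)))" for n
  proof -
    have "A - F \<subseteq> S n \<union> (\<Union>j. R (j + n))"
    proof
      fix x assume x: "x \<in> A - F"
      then have pos: "0 < infdist x F"
        using F ne by (metis DiffD2 infdist_pos_not_in_closed)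
      show "x \<in> S n \<union> (\<Union>j. R (j + n))"
      proof (cases "x \<in> S n")
        case False
        define P where "P m \<longleftrightarrow> 1 / (real m + 1) \<le> infdist x F" for m
        obtain m where "inverse (real (Suc m)) < infdist x F"
          using reals_Archimedean[OF pos] by blast
        then have ex: "P m" by (simp add: P_def inverse_eq_divide add.commute)
        define l where "l = (LEAST m. P m)"
        have l: "P l" unfolding l_def using ex by (rule LeastI)
        have nP: "\<not> P n" using False x by (auto simp: S_def P_def)
        have "n < l"
        proof (rule ccontr)
          assume "\<not> n < l"
          then have "1 / (real n + 1) \<le> 1 / (real l + 1)" by (intro divide_left_mono) auto
          with l nP show False by (simp add: P_def)
        qed
        then obtain j where j: "l = Suc (j + n)" using less_imp_Suc_add by (metis add.commute)
        then have "\<not> P (j + n)" unfolding l_def by (intro not_less_Least) simp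
        with l have "1 / (real (j + n) + 2) \<le> infdist x F" "infdist x F < 1 / (real (j + n) + 1)"
          by (simp_all add: P_def j not_le add_ac)
        then have "x \<in> R (j + n)" using x by (simp add: R_def)
        then show ?thesis by blast
      qed auto
    qed
    then have "hausdorff_outer d (A - F) \<le> hausdorff_outer d (S n) + hausdorff_outer d (\<Union>j. R (j + n))"
      by (metis hausdorff_outer_Un hausdorff_outer_mono order_trans)
    also have "\<dots> \<le> hausdorff_outer d (S n) + (\<Sum>j. hausdorff_outer d (R (j + n)))"
      by (intro add_left_mono hausdorff_outer_countably_subadditive)
    finally have "hausdorff_outer d (A \<inter> F) + hausdorff_outer d (A - F) \<le>
        (hausdorff_outer d (A \<inter> F) + hausdorff_outer d (S n)) + (\<Sum>j. hausdorff_outer d (R (j + n)))"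
      by (simp add: add.assoc add_left_mono)
    also have "hausdorff_outer d (A \<inter> F) + hausdorff_outer d (S n) \<le> hausdorff_outer d A"
    proof -
      have "hausdorff_outer d (A \<inter> F) + hausdorff_outer d (S n) \<le> hausdorff_outer d (A \<inter> F \<union> S n)"
      proof (rule hausdorff_outer_separated)
        show "0 < 1 / (real n + 1)" by simp
        fix x y assume "x \<in> A \<inter> F" "y \<in> S n"
        then show "1 / (real n + 1) \<le> dist x y"
          using infdist_le[of x F y] by (auto simp: S_def dist_commute)
      qed
      also have "\<dots> \<le> hausdorff_outer d A" by (intro hausdorff_outer_mono) (auto simp: S_def)
      finally show ?thesis .
    qed
    finally show ?thesis by (simp add: add_right_mono)
  qed
  moreover have "(\<lambda>n. hausdorff_outer d A + (\<Sum>j. hausdorff_outer d (R (j + n)))) \<longlonglongrightarrow> hausdorff_outer d A + 0"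
    by (intro tendsto_add tendsto_const tail)
  ultimately show ?thesis
    by (intro LIMSEQ_le_const[of _ "hausdorff_outer d A"]) auto
qed

text \<open>Caratheodory's criterion: the construction does give a Borel measure.\<close>

lemma emeasure_hausdorff_measure:
  fixes A :: "'a::metric_space set"
  assumes "A \<in> sets borel"
  shows "emeasure (hausdorff_measure d) A = hausdorff_outer d A"
proof -
  let ?L = "lambda_system UNIV UNIV (hausdorff_outer d) :: 'a set set"
  have ms: "measure_space UNIV ?L (hausdorff_outer d)"
    using sigma_algebra.caratheodory_lemma[OF sigma_algebra_Pow, of UNIV "hausdorff_outer d"]
      hausdorff_outer_measure_space[of d] by simp
  then have sa: "sigma_algebra UNIV ?L" by (simp add: measure_space_def)
  have "{S. closed S} \<subseteq> ?L"
  proof safe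
    fix F :: "'a set" assume "closed F"
    then show "F \<in> ?L"
      using closed_hausdorff_caratheodory[of F d] hausdorff_outer_Un[of d "B \<inter> F" "B - F" for B]
      by (auto simp: lambda_system_def Int_commute Diff_eq[symmetric] Compl_eq_Diff_UNIV[symmetric]
          Int_Diff_Un intro!: antisym)
  qed
  then have "sigma_sets UNIV {S. closed S} \<subseteq> ?L"
    by (rule sigma_algebra.sigma_sets_subset[OF sa])
  then have sub: "sets borel \<subseteq> ?L" by (simp add: borel_eq_closed)
  have "measure_space UNIV (sets (borel :: 'a measure)) (hausdorff_outer d)"
    using ms sub sets.sigma_algebra_axioms[of "borel :: 'a measure"]
    by (auto simp: measure_space_def positive_def countably_additive_def)
  then show ?thesis
    using assms unfolding hausdorff_measure_def
    by (intro emeasure_measure_of_sigma) (auto simp: measure_space_def intro: sets.sigma_algebra_axioms[of borel, simplified])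
qed

definition surface_measure :: "(real ^ 'n) measure" where
  "surface_measure = hausdorff_measure (CARD('n) - 1)"


section \<open>Mesh cells and averages\<close>

text \<open>
  The surface measure of the boundary has to be positive and finite for the average over the
  boundary to make sense.
\<close>

definition mesh_cell :: "(real ^ 'n) set \<Rightarrow> bool" where
  "mesh_cell K \<longleftrightarrow> compact K \<and> interior K \<noteq> {} \<and>
     0 < emeasure surface_measure (frontier K) \<and> emeasure surface_measure (frontier K) < \<infinity>"

definition cell_avg :: "(real ^ 'n) set \<Rightarrow> (real ^ 'n \<Rightarrow> real) \<Rightarrow> real" where
  "cell_avg K U = (LINT x:K|lborel. U x) / measure lborel K"

definition bdry_avg :: "(real ^ 'n) set \<Rightarrow> (real ^ 'n \<Rightarrow> real) \<Rightarrow> real" where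
  "bdry_avg K U = (LINT x:frontier K|surface_measure. U x) / measure surface_measure (frontier K)"

definition bdry_ratio :: "(real ^ 'n) set \<Rightarrow> (real ^ 'n \<Rightarrow> real) \<Rightarrow> real" where
  "bdry_ratio K U = bdry_avg K U / cell_avg K U"

definition retentional :: "(real ^ 'n) set \<Rightarrow> real \<Rightarrow> (real ^ 'n \<Rightarrow> real) \<Rightarrow> real" where
  "retentional K M U = M * cell_avg K U - bdry_avg K U"


section \<open>Polynomial spaces\<close>

global_interpretation fun_vs: vector_space "\<lambda>(c::real) (f :: 'a \<Rightarrow> real) x. c * f x"
  by unfold_locales (auto simp: fun_eq_iff algebra_simps)

text \<open>Polynomials over the infinite field of reals are identified with their functions.\<close>

definition poly_space :: "(real ^ 'n \<Rightarrow> real) set \<Rightarrow> bool" where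
  "poly_space V \<longleftrightarrow> (\<forall>U\<in>V. real_polynomial_function U) \<and>
     fun_vs.subspace V \<and> (\<exists>B. finite B \<and> fun_vs.span B = V)"

definition polys_deg_le :: "nat \<Rightarrow> (real ^ 'n \<Rightarrow> real) set" where
  "polys_deg_le k =
     fun_vs.span {(\<lambda>x. \<Prod>i\<in>UNIV. (x $ i) ^ a i) | a :: 'n \<Rightarrow> nat. (\<Sum>i\<in>UNIV. a i) \<le> k}"

definition pos_polys :: "(real ^ 'n) set \<Rightarrow> (real ^ 'n \<Rightarrow> real) set \<Rightarrow> (real ^ 'n \<Rightarrow> real) set" where
  "pos_polys K V = {U \<in> V. (\<forall>x\<in>K. 0 \<le> U x) \<and> 0 < cell_avg K U}"

definition Mstar :: "(real ^ 'n) set \<Rightarrow> (real ^ 'n \<Rightarrow> real) set \<Rightarrow> real" where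
  "Mstar K V = (SUP U \<in> pos_polys K V. bdry_ratio K U)"

definition optimizer :: "(real ^ 'n) set \<Rightarrow> (real ^ 'n \<Rightarrow> real) set \<Rightarrow> (real ^ 'n \<Rightarrow> real) \<Rightarrow> bool" where
  "optimizer K V U \<longleftrightarrow> U \<in> pos_polys K V \<and> bdry_ratio K U = Mstar K V"


section \<open>Boundary-weighted quadrature\<close>

definition quadrature_rule ::
    "(real ^ 'n) set \<Rightarrow> (real ^ 'n \<Rightarrow> real) set \<Rightarrow> (real ^ 'n) set \<Rightarrow> (real ^ 'n \<Rightarrow> real) \<Rightarrow> real \<Rightarrow> bool" where
  "quadrature_rule K V X w W \<longleftrightarrow>
     finite X \<and> X \<subseteq> K \<and> (\<forall>x\<in>X. 0 < w x) \<and> 0 < W \<and>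
     (\<forall>U\<in>V. cell_avg K U = (\<Sum>x\<in>X. w x * U x) + W * bdry_avg K U)"


section \<open>Symmetries of the cell\<close>

definition cell_isometries :: "(real ^ 'n) set \<Rightarrow> (real ^ 'n \<Rightarrow> real ^ 'n) set" where
  "cell_isometries K = {g. (\<forall>x y. dist (g x) (g y) = dist x y) \<and> g ` K = K}"

definition invariant_space :: "(real ^ 'n) set \<Rightarrow> (real ^ 'n \<Rightarrow> real) set \<Rightarrow> bool" where
  "invariant_space K V \<longleftrightarrow> (\<forall>g\<in>cell_isometries K. \<forall>U\<in>V. U \<circ> g \<in> V)"

definition invariant_fun :: "(real ^ 'n) set \<Rightarrow> (real ^ 'n \<Rightarrow> real) \<Rightarrow> bool" where
  "invariant_fun K U \<longleftrightarrow> (\<forall>g\<in>cell_isometries K. U \<circ> g = U)"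

definition invariant_rule :: "(real ^ 'n) set \<Rightarrow> (real ^ 'n) set \<Rightarrow> (real ^ 'n \<Rightarrow> real) \<Rightarrow> bool" where
  "invariant_rule K X w \<longleftrightarrow> (\<forall>g\<in>cell_isometries K. g ` X = X \<and> (\<forall>x\<in>X. w (g x) = w x))"

text \<open>For a polytopal cell the symmetry group is finite, since it permutes the vertices.\<close>

lemma finite_cell_isometries_polytope:
  fixes K :: "(real ^ 'n) set"
  assumes K: "polytope K" "interior K \<noteq> {}"
  shows "finite (cell_isometries K)"
proof -
  define E where "E = {x. x extreme_point_of K}"
  have "finite E"
    unfolding E_def using K(1) by (simp add: finite_polyhedron_extreme_points polytope_imp_polyhedron)
  have hull: "K = convex hull E"
    unfolding E_def using K(1) by (intro Krein_Milman_Minkowski) (auto intro: polytope_imp_compact polytope_imp_convex)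
  have lin: "linear (\<lambda>x. g x - g 0)" if "g \<in> cell_isometries K" for g
    using that by (intro isometry_linear) (auto simp: cell_isometries_def dist_norm)
  have comb: "g (u *\<^sub>R x + v *\<^sub>R y) = u *\<^sub>R g x + v *\<^sub>R g y"
    if g: "g \<in> cell_isometries K" and uv: "u + v = 1" for g u v x y
  proof -
    have "g (u *\<^sub>R x + v *\<^sub>R y) - g 0 = u *\<^sub>R (g x - g 0) + v *\<^sub>R (g y - g 0)"
      using linear_add[OF lin[OF g], of "u *\<^sub>R x" "v *\<^sub>R y"]
        linear_cmul[OF lin[OF g], of u x] linear_cmul[OF lin[OF g], of v y] by (simp only:)
    also have "\<dots> = u *\<^sub>R g x + v *\<^sub>R g y - (u + v) *\<^sub>R g 0" by (simp add: algebra_simps)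
    finally show ?thesis by (simp add: uv)
  qed
  have inj: "g y = g z \<longleftrightarrow> y = z" if "g \<in> cell_isometries K" for g y z
  proof -
    have "dist (g y) (g z) = dist y z" using that by (simp add: cell_isometries_def)
    then show ?thesis using dist_eq_0_iff[of "g y" "g z"] dist_eq_0_iff[of y z] by simp
  qed
  have maps: "g x \<in> E" if g: "g \<in> cell_isometries K" and x: "x \<in> E" for g x
  proof -
    have gK: "g ` K = K" using g by (simp add: cell_isometries_def)
    have "g x \<notin> open_segment (g a) (g b)" if ab: "a \<in> K" "b \<in> K" for a b
    proof
      assume "g x \<in> open_segment (g a) (g b)"
      then obtain u where u: "g a \<noteq> g b" "0 < u" "u < 1" "g x = (1 - u) *\<^sub>R g a + u *\<^sub>R g b"
        unfolding in_segment by blast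
      have "g ((1 - u) *\<^sub>R a + u *\<^sub>R b) = (1 - u) *\<^sub>R g a + u *\<^sub>R g b"
        by (intro comb g) simp
      with u inj[OF g] have "x = (1 - u) *\<^sub>R a + u *\<^sub>R b" by metis
      then have "x \<in> open_segment a b" using u unfolding in_segment by blast
      then show False using x ab unfolding E_def extreme_point_of_def by blast
    qed
    moreover have "g x \<in> K" using x gK unfolding E_def extreme_point_of_def by blast
    ultimately have "g x extreme_point_of g ` K"
      unfolding extreme_point_of_def gK by (metis gK imageE)
    then show ?thesis by (simp add: E_def gK)
  qed
  have "inj_on (\<lambda>g. restrict g E) (cell_isometries K)"
  proof (rule inj_onI)
    fix g g' assume g: "g \<in> cell_isometries K" "g' \<in> cell_isometries K" "restrict g E = restrict g' E"
    have "E \<subseteq> {x. g x = g' x}"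
    proof
      fix x assume "x \<in> E"
      then show "x \<in> {x. g x = g' x}" using fun_cong[OF g(3), of x] by simp
    qed
    moreover have "affine {x. g x = g' x}"
      using g(1,2) by (auto simp: affine_def comb)
    ultimately have "affine hull E \<subseteq> {x. g x = g' x}" by (rule hull_minimal)
    moreover have "affine hull E = UNIV"
      using affine_hull_nonempty_interior[OF K(2)] by (simp add: hull affine_hull_convex_hull)
    ultimately show "g = g'" by auto
  qed
  moreover have "(\<lambda>g. restrict g E) ` cell_isometries K \<subseteq> E \<rightarrow>\<^sub>E E"
    using maps by auto
  moreover have "finite (E \<rightarrow>\<^sub>E E)"
    using \<open>finite E\<close> by (intro finite_PiE) auto
  ultimately show ?thesis by (metis finite_imageD finite_subset)
qed

section \<open>Linear damping\<close>

definition damp :: "(real ^ 'n) set \<Rightarrow> real \<Rightarrow> (real ^ 'n \<Rightarrow> real) \<Rightarrow> (real ^ 'n \<Rightarrow> real)" where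
  "damp K \<theta> U = (\<lambda>x. cell_avg K U + \<theta> * (U x - cell_avg K U))"

definition damping_factor :: "(real ^ 'n) set \<Rightarrow> real \<Rightarrow> (real ^ 'n \<Rightarrow> real) \<Rightarrow> real" where
  "damping_factor K M U = (GREATEST \<theta>. \<theta> \<in> {0..1} \<and> 0 \<le> retentional K M (damp K \<theta> U))"

text \<open>
  \<open>sup\<^sub>K |U\<^sub>\<delta> - u\<^sub>\<delta>| = O(\<delta>\<^sup>m)\<close> as \<open>\<delta> \<rightarrow> 0+\<close>.  The supremum is spelled out pointwise since
  the real-valued supremum of an unbounded set has no meaning.
\<close>

definition sup_error_bigo ::
    "(real ^ 'n) set \<Rightarrow> nat \<Rightarrow> (real \<Rightarrow> real ^ 'n \<Rightarrow> real) \<Rightarrow> (real \<Rightarrow> real ^ 'n \<Rightarrow> real) \<Rightarrow> bool" where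
  "sup_error_bigo K m U u \<longleftrightarrow>
     (\<exists>c. \<forall>\<^sub>F \<delta> in at_right 0. \<forall>x\<in>K. \<bar>U \<delta> x - u \<delta> x\<bar> \<le> c * \<delta> ^ m)"

definition damping_retains_accuracy ::
    "(real ^ 'n) set \<Rightarrow> (real ^ 'n \<Rightarrow> real) set \<Rightarrow> nat \<Rightarrow> real \<Rightarrow> bool" where
  "damping_retains_accuracy K V k M \<longleftrightarrow>
     (\<forall>u U. (\<forall>\<delta>>0. \<forall>x\<in>K. 0 \<le> u \<delta> x) \<longrightarrow>
        (\<forall>\<delta>>0. U \<delta> \<in> V \<and> 0 \<le> cell_avg K (U \<delta>)) \<longrightarrow>
        sup_error_bigo K (k + 1) U u \<longrightarrow>
        sup_error_bigo K (k + 1) (\<lambda>\<delta>. damp K (damping_factor K M (U \<delta>)) (U \<delta>)) u)"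

end

theory Submission
  imports Defs
begin

text \<open>
  On the cone of polynomials in \<open>V\<close> that are nonnegative on the cell, the cell average is strictly
  positive away from 0, because a polynomial that vanishes on the interior of the cell is 0.  As the
  cone is closed and lives in finitely many coordinates, its slice of cell average 1 is compact
  (\<open>compact_cone_base\<close>).  Three things follow.  The boundary average has a maximum on the slice, which is
  \<open>Mstar K V\<close>; so optimizers exist and \<open>bdry_avg \<le> Mstar * cell_avg\<close> on the whole cone.  The supremum over
  the cell is bounded by a multiple of the cell average, which is what damping needs: an error \<open>e\<close> in the
  positivity of \<open>U\<close> costs at most a multiple of \<open>e\<close> after damping (\<open>damping_factor_bounds\<close>).  Finally,
  among the optimizers of cell average 1 one has a square of least average.

  Weak duality, that is the bracket, the sufficiency of the retentional points and the location of
  zeros, comes from evaluating a quadrature rule at nonnegative polynomials.  Strong duality asks for a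
  rule with boundary weight \<open>1 / Mstar\<close>.  The functional \<open>cell_avg - bdry_avg / Mstar\<close> is nonnegative on
  the cone, and every such functional is a positive combination of finitely many point evaluations
  (\<open>nonneg_functional_representation\<close>); this is a theorem of Tchakaloff type, and rests on a separation
  lemma for compact sets in finitely many coordinates (\<open>convex_combination_zero\<close>).

  Isometries of the cell preserve both averages, since they preserve Lebesgue measure and Hausdorff
  measure.  The optimizer with the least square is unique by strict convexity and therefore invariant,
  even under an infinite group.  A rule is made invariant by averaging it over a finite group.
\<close>

section \<open>Separation of a compact set from the origin in finitely many coordinates\<close>

text \<open>
  If no slope worked, the sets of points violating slope \<open>n\<close> would be nested, compact and nonempty,
  and a common point would lie on the axis \<open>x = 0\<close> with \<open>y \<le> 0\<close>.
\<close>

lemma half_plane_slope: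
  fixes D :: "(real \<times> real) set"
  assumes D: "compact D" and nn: "\<And>x y. (x, y) \<in> D \<Longrightarrow> 0 \<le> x"
    and pos: "\<And>y. (0, y) \<in> D \<Longrightarrow> 0 < y"
  shows "\<exists>c. \<forall>(x, y)\<in>D. 0 < y + c * x"
proof (rule ccontr)
  assume no: "\<not> ?thesis"
  define F where "F n = D \<inter> {p. snd p + real n * fst p \<le> 0}" for n
  have "\<Inter> (range F) \<noteq> {}"
  proof (rule compact_nest)
    show "compact (F n)" for n
      unfolding F_def by (intro compact_Int_closed D closed_Collect_le continuous_intros)
    show "F n \<noteq> {}" for n
      using no unfolding F_def by (fastforce simp: not_less)
    show "F n \<subseteq> F m" if "m \<le> n" for m n
    proof -
      have "real m * x \<le> real n * x" if "0 \<le> x" for x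
        using \<open>m \<le> n\<close> that by (intro mult_right_mono) auto
      then show ?thesis unfolding F_def using nn by fastforce
    qed
  qed
  then obtain x y where xy: "\<And>n. (x, y) \<in> F n" by auto
  have inD: "(x, y) \<in> D" and yx: "real n * x \<le> - y" for n
    using xy[of n] by (auto simp: F_def)
  have x: "0 \<le> x" by (rule nn[OF inD])
  have "x = 0"
  proof (rule ccontr)
    assume "x \<noteq> 0"
    then obtain n where "- y < real n * x" using x ex_less_of_nat_mult[of x "- y"] by force
    with yx[of n] show False by simp
  qed
  with inD pos[of y] yx[of 0] show False by simp
qed

text \<open>
  The hypothesis forces every chord between two points of \<open>D\<close> to meet the axis \<open>x = 0\<close> only above the
  origin.  A slope can fail because of a point on the right or because of a point on the left; both
  sets of failing slopes are closed and neither is the whole line.  If they covered the line they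
  would meet, since the line is connected, and the chord between the two corresponding points would
  cross the axis at or below the origin.
\<close>

lemma planar_separation:
  fixes D :: "(real \<times> real) set"
  assumes D: "compact D"
    and pos: "\<And>x y x' y' a b. (x, y) \<in> D \<Longrightarrow> (x', y') \<in> D \<Longrightarrow> 0 \<le> a \<Longrightarrow> 0 \<le> b \<Longrightarrow> a + b = 1 \<Longrightarrow>
      a * x + b * x' = 0 \<Longrightarrow> 0 < a * y + b * y'"
  shows "\<exists>c. \<forall>(x, y)\<in>D. 0 < y + c * x"
proof (rule ccontr)
  assume no: "\<not> ?thesis"
  have pos0: "0 < y" if "(0, y) \<in> D" for y using pos[of 0 y 0 y 1 0] that by simp
  define R where "R = D \<inter> {p. 0 \<le> fst p}"
  define L where "L = D \<inter> {p. fst p \<le> 0}"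
  define bad where "bad E = {c. \<exists>p. p \<in> E \<and> (p, c) \<in> {q :: (real \<times> real) \<times> real. snd (fst q) + snd q * fst (fst q) \<le> 0}}" for E
  have cR: "compact R" and cL: "compact L"
    unfolding R_def L_def by (intro compact_Int_closed D closed_Collect_le continuous_intros)+
  have clo: "closed (bad E)" if "compact E" for E
    unfolding bad_def by (intro closed_compact_projection that closed_Collect_le continuous_intros)
  have cover: "bad R \<union> bad L = UNIV"
  proof -
    have "\<exists>x y. (x, y) \<in> D \<and> y + c * x \<le> 0" for c using no by (fastforce simp: not_less)
    then show ?thesis unfolding bad_def R_def L_def by fastforce
  qed
  have "\<exists>c. \<forall>(x, y)\<in>R. 0 < y + c * x"
    by (rule half_plane_slope[OF cR]) (auto simp: R_def pos0)
  then have "bad R \<noteq> UNIV"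
  proof (elim exE)
    fix c assume c: "\<forall>(x, y)\<in>R. 0 < y + c * x"
    have "c \<notin> bad R" using c unfolding bad_def by fastforce
    then show ?thesis by blast
  qed
  moreover have "\<exists>c. \<forall>(x, y)\<in>(\<lambda>p. (- fst p, snd p)) ` L. 0 < y + c * x"
    by (rule half_plane_slope) (auto simp: L_def pos0 intro!: compact_continuous_image continuous_intros cL[unfolded L_def])
  then have "bad L \<noteq> UNIV"
  proof (elim exE)
    fix c assume c: "\<forall>(x, y)\<in>(\<lambda>p. (- fst p, snd p)) ` L. 0 < y + c * x"
    have "- c \<notin> bad L" using c unfolding bad_def by fastforce
    then show ?thesis by blast
  qed
  ultimately obtain c where c: "c \<in> bad R" "c \<in> bad L"
    using connected_closedD[OF connected_UNIV, of "bad R" "bad L"] cover clo[OF cR] clo[OF cL] by auto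
  obtain x y where xy: "(x, y) \<in> D" "0 \<le> x" "y + c * x \<le> 0"
    using c(1) unfolding bad_def R_def by auto
  obtain x' y' where xy': "(x', y') \<in> D" "x' \<le> 0" "y' + c * x' \<le> 0"
    using c(2) unfolding bad_def L_def by auto
  note xy = xy xy'
  show False
  proof (cases "x - x' = 0")
    case True
    then show False using xy pos0[of y] by auto
  next
    case False
    \<comment> \<open>barycentric coordinates of the crossing point of the chord with the axis\<close>
    define a where "a = - x' / (x - x')"
    define b where "b = x / (x - x')"
    have ab: "0 \<le> a" "0 \<le> b" "a + b = 1" "a * x + b * x' = 0"
      using False xy by (auto simp: a_def b_def field_simps diff_divide_distrib[symmetric])
    have "a * y + b * y' \<le> a * (- c * x) + b * (- c * x')"
      using xy ab by (intro add_mono mult_left_mono) auto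
    also have "\<dots> = - c * (a * x + b * x')" by (simp add: algebra_simps)
    finally show False using pos[OF xy(1,4) ab] ab by simp
  qed
qed

lemma sum_lessThan_add:
  fixes f :: "nat \<Rightarrow> real"
  shows "(\<Sum>k<m + n. f k) = (\<Sum>k<m. f k) + (\<Sum>k<n. f (m + k))"
  by (induction n) (auto simp: add.assoc)

text \<open>
  The proof eliminates one coordinate \<open>j\<close> at a time, in the manner of Fourier and Motzkin: \<open>T\<close> is
  replaced by the set of all points on segments between two of its members at which coordinate \<open>j\<close>
  vanishes.  The planar separation lemma turns a functional positive on this set into one positive on
  \<open>T\<close>, so the hypothesis passes to the new set.  Segments are used rather than the full convex hull
  because their compactness is immediate.
\<close>

lemma convex_combination_zero:
  fixes T :: "('i \<Rightarrow> real) set"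
  assumes "finite I" "compact T"
    and "\<And>c :: 'i \<Rightarrow> real. \<exists>\<tau>\<in>T. (\<Sum>i\<in>I. c i * \<tau> i) \<le> 0"
  shows "\<exists>(n::nat) p w. (\<forall>k<n. p k \<in> T \<and> 0 \<le> w k) \<and> (\<Sum>k<n. w k) = 1 \<and>
    (\<forall>i\<in>I. (\<Sum>k<n. w k * p k i) = 0)"
  using assms
proof (induction I arbitrary: T rule: finite_induct)
  case empty
  then obtain \<tau> where "\<tau> \<in> T" by auto
  then show ?case by (intro exI[of _ 1] exI[of _ "\<lambda>_. \<tau>"] exI[of _ "\<lambda>_. 1"]) auto
next
  case (insert j I)
  define mix where "mix q = (\<lambda>i. snd (snd q) * fst q i + (1 - snd (snd q)) * fst (snd q) i)"
    for q :: "('i \<Rightarrow> real) \<times> ('i \<Rightarrow> real) \<times> real"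
  have coord: "continuous_on UNIV (\<lambda>\<tau> :: 'i \<Rightarrow> real. \<tau> i)" for i by simp
  have c1: "continuous_on UNIV (\<lambda>q :: ('i \<Rightarrow> real) \<times> ('i \<Rightarrow> real) \<times> real. fst q i)" for i
    by (rule continuous_on_compose2[OF coord]) (intro continuous_intros subset_UNIV)+
  have c2: "continuous_on UNIV (\<lambda>q :: ('i \<Rightarrow> real) \<times> ('i \<Rightarrow> real) \<times> real. fst (snd q) i)" for i
    by (rule continuous_on_compose2[OF coord]) (intro continuous_intros subset_UNIV)+
  have mix: "continuous_on UNIV mix"
    unfolding mix_def by (intro continuous_on_coordinatewise_then_product continuous_intros c1 c2)
  define T' where "T' = mix ` (T \<times> T \<times> {0..1}) \<inter> {\<tau>. \<tau> j = 0}"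
  have T': "compact T'"
    unfolding T'_def
    by (intro compact_Int_closed compact_continuous_image compact_Times insert.prems(1)
        continuous_on_subset[OF mix] closed_Collect_eq coord) auto
  have "\<exists>\<tau>\<in>T'. (\<Sum>i\<in>I. c i * \<tau> i) \<le> 0" for c :: "'i \<Rightarrow> real"
  proof (rule ccontr)
    assume neg: "\<not> ?thesis"
    define h where "h \<tau> = (\<Sum>i\<in>I. c i * \<tau> i)" for \<tau> :: "'i \<Rightarrow> real"
    have ch: "continuous_on UNIV h" unfolding h_def by (intro continuous_intros coord)
    have "\<exists>e. \<forall>(x, y)\<in>(\<lambda>\<tau>. (\<tau> j, h \<tau>)) ` T. 0 < y + e * x"
    proof (rule planar_separation)
      show "compact ((\<lambda>\<tau>. (\<tau> j, h \<tau>)) ` T)"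
        by (intro compact_continuous_image insert.prems(1) continuous_intros
            continuous_on_subset[OF ch] continuous_on_subset[OF coord]) auto
      fix x y x' y' a b :: real
      assume "(x, y) \<in> (\<lambda>\<tau>. (\<tau> j, h \<tau>)) ` T" "(x', y') \<in> (\<lambda>\<tau>. (\<tau> j, h \<tau>)) ` T"
      then obtain \<tau> \<sigma> where \<tau>: "\<tau> \<in> T" "\<sigma> \<in> T" "x = \<tau> j" "x' = \<sigma> j" "y = h \<tau>" "y' = h \<sigma>" by auto
      assume ab: "0 \<le> a" "0 \<le> b" "a + b = 1" "a * x + b * x' = 0"
      then have b: "b = 1 - a" by simp
      have "mix (\<tau>, \<sigma>, a) \<in> T'" using \<tau> ab by (auto simp: T'_def b) (simp add: mix_def)
      then have "0 < h (mix (\<tau>, \<sigma>, a))" using neg by (auto simp: h_def)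
      also have "h (mix (\<tau>, \<sigma>, a)) = a * y + b * y'"
        by (simp add: \<tau> h_def mix_def b sum_distrib_left sum.distrib[symmetric] algebra_simps)
      finally show "0 < a * y + b * y'" .
    qed
    then obtain e where e: "\<And>\<tau>. \<tau> \<in> T \<Longrightarrow> 0 < h \<tau> + e * \<tau> j" by auto
    have "(\<Sum>i\<in>insert j I. (c(j := e)) i * \<tau> i) = h \<tau> + e * \<tau> j" for \<tau>
    proof -
      have "(\<Sum>i\<in>I. (c(j := e)) i * \<tau> i) = h \<tau>"
        unfolding h_def using insert.hyps by (intro sum.cong) auto
      then show ?thesis using insert.hyps by simp
    qed
    moreover obtain \<tau> where "\<tau> \<in> T" "(\<Sum>i\<in>insert j I. (c(j := e)) i * \<tau> i) \<le> 0"
      using insert.prems(2) by blast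
    ultimately show False using e by fastforce
  qed
  \<comment> \<open>Each of the \<open>n\<close> points found for \<open>T'\<close> splits into the two endpoints of its segment.\<close>
  from insert.IH[OF T' this] obtain n :: nat and p w where
    p: "\<forall>k<n. p k \<in> T' \<and> 0 \<le> w k" and sw: "(\<Sum>k<n. w k) = 1"
    and zero: "\<forall>i\<in>I. (\<Sum>k<n. w k * p k i) = 0"
    by blast
  have "\<forall>k. \<exists>\<sigma> \<tau> a. k < n \<longrightarrow> \<sigma> \<in> T \<and> \<tau> \<in> T \<and> 0 \<le> a \<and> a \<le> 1 \<and> p k = mix (\<sigma>, \<tau>, a)"
    using p by (fastforce simp: T'_def)
  then obtain \<sigma> \<tau> a where
    split: "\<And>k. k < n \<Longrightarrow> \<sigma> k \<in> T \<and> \<tau> k \<in> T \<and> 0 \<le> a k \<and> a k \<le> 1 \<and> p k = mix (\<sigma> k, \<tau> k, a k)"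
    by metis
  have pj: "p k j = 0" if "k < n" for k using p that by (auto simp: T'_def)
  define p' where "p' k = (if k < n then \<sigma> k else \<tau> (k - n))" for k
  define w' where "w' k = (if k < n then w k * a k else w (k - n) * (1 - a (k - n)))" for k
  have sum': "(\<Sum>k<n + n. w' k * f (p' k)) = (\<Sum>k<n. w k * (a k * f (\<sigma> k) + (1 - a k) * f (\<tau> k)))"
    for f :: "('i \<Rightarrow> real) \<Rightarrow> real"
    by (simp add: sum_lessThan_add w'_def p'_def sum.distrib[symmetric] algebra_simps)
  have "(\<Sum>k<n + n. w' k) = 1" using sum'[of "\<lambda>_. 1"] sw by simp
  moreover have "(\<Sum>k<n + n. w' k * p' k i) = (\<Sum>k<n. w k * p k i)" for i
    using sum'[of "\<lambda>\<tau>. \<tau> i"] split by (simp add: mix_def)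
  then have "\<forall>i\<in>insert j I. (\<Sum>k<n + n. w' k * p' k i) = 0" using zero pj by simp
  moreover have "\<forall>k<n + n. p' k \<in> T \<and> 0 \<le> w' k"
    using split p by (auto simp: p'_def w'_def)
  ultimately show ?case by blast
qed

section \<open>Compact bases of closed cones\<close>

lemma compact_coordinate_box:
  "compact {c :: 'i \<Rightarrow> real. (\<forall>i\<in>J. \<bar>c i\<bar> \<le> N) \<and> (\<forall>i. i \<notin> J \<longrightarrow> c i = 0)}"
proof -
  have "compactin (product_topology (\<lambda>_::'i. euclideanreal) UNIV)
      (PiE UNIV (\<lambda>i. if i \<in> J then {-N..N} else {0}))"
    by (subst compactin_PiE) auto
  moreover have "PiE UNIV (\<lambda>i. if i \<in> J then {-N..N} else {0}) =
      {c :: 'i \<Rightarrow> real. (\<forall>i\<in>J. \<bar>c i\<bar> \<le> N) \<and> (\<forall>i. i \<notin> J \<longrightarrow> c i = 0)}"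
    by (auto simp: PiE_def Pi_iff abs_le_iff split: if_splits) (metis minus_le_iff)+
  ultimately show ?thesis by (simp add: euclidean_product_topology)
qed

lemma continuous_on_coordinate: "continuous_on A (\<lambda>c :: 'i \<Rightarrow> real. c i)"
  by (rule continuous_on_subset[OF continuous_on_product_coordinates]) simp

text \<open>
  On the part of the cone where the coordinates have absolute sum 1, which is compact, the functional
  has a positive minimum; this bounds the coordinates on the slice where the functional equals 1.
\<close>

lemma compact_cone_base:
  fixes P :: "('i \<Rightarrow> real) set" and l :: "'i \<Rightarrow> real"
  assumes P: "closed P" and J: "finite J" and supp: "\<And>c i. c \<in> P \<Longrightarrow> i \<notin> J \<Longrightarrow> c i = 0"
    and cone: "\<And>c t. c \<in> P \<Longrightarrow> 0 \<le> t \<Longrightarrow> (\<lambda>i. t * c i) \<in> P"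
    and pos: "\<And>c i. c \<in> P \<Longrightarrow> c i \<noteq> 0 \<Longrightarrow> 0 < (\<Sum>i\<in>J. c i * l i)"
  shows "compact {c \<in> P. (\<Sum>i\<in>J. c i * l i) = 1}"
proof -
  define box where "box N = {c :: 'i \<Rightarrow> real. (\<forall>i\<in>J. \<bar>c i\<bar> \<le> N) \<and> (\<forall>i. i \<notin> J \<longrightarrow> c i = 0)}" for N
  have cbox: "compact (box N)" for N unfolding box_def by (rule compact_coordinate_box)
  define L where "L c = (\<Sum>i\<in>J. c i * l i)" for c
  have cL: "continuous_on A L" for A
    unfolding L_def by (intro continuous_intros continuous_on_coordinate)
  define S where "S = box 1 \<inter> P \<inter> {c. (\<Sum>i\<in>J. \<bar>c i\<bar>) = 1}"
  have "compact S"
    unfolding S_def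
    by (intro compact_Int_closed cbox P closed_Collect_eq continuous_intros continuous_on_coordinate)
  have normalise: "(\<lambda>i. inverse (\<Sum>i\<in>J. \<bar>c i\<bar>) * c i) \<in> S" if "c \<in> P" "0 < (\<Sum>i\<in>J. \<bar>c i\<bar>)" for c
  proof -
    let ?s = "\<Sum>i\<in>J. \<bar>c i\<bar>"
    have "\<bar>c i\<bar> \<le> ?s" if "i \<in> J" for i by (rule member_le_sum) (use that J in auto)
    moreover have "(\<Sum>i\<in>J. \<bar>inverse ?s * c i\<bar>) = 1"
      using that(2) by (simp add: abs_mult sum_distrib_left[symmetric])
    ultimately show ?thesis
      using that supp cone[OF that(1), of "inverse ?s"] unfolding S_def box_def
      by (auto simp: abs_mult field_simps)
  qed
  have bounded: "\<exists>N. {c \<in> P. L c = 1} \<subseteq> box N"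
  proof (cases "S = {}")
    case True
    have "L c \<noteq> 1" if "c \<in> P" for c
    proof
      assume "L c = 1"
      then have "(\<Sum>i\<in>J. c i * l i) \<noteq> 0" by (simp add: L_def)
      then obtain i where "i \<in> J" "c i * l i \<noteq> 0" by (rule sum.not_neutral_contains_not_neutral)
      then have i: "i \<in> J" "c i \<noteq> 0" by auto
      have "0 < (\<Sum>i\<in>J. \<bar>c i\<bar>)" by (rule sum_pos2[OF J i(1)]) (use i in auto)
      with normalise[OF that] True show False by simp
    qed
    then show ?thesis by auto
  next
    case False
    obtain c0 where c0: "c0 \<in> S" "\<And>c. c \<in> S \<Longrightarrow> L c0 \<le> L c"
      using continuous_attains_inf[OF \<open>compact S\<close> False cL] by auto
    have "\<exists>i. c0 i \<noteq> 0"
    proof (rule ccontr)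
      assume "\<not> ?thesis"
      then show False using c0(1) by (simp add: S_def)
    qed
    with c0(1) pos have "0 < L c0" unfolding L_def S_def by blast
    have "\<bar>c i\<bar> \<le> inverse (L c0)" if c: "c \<in> P" "L c = 1" and i: "i \<in> J" for c i
    proof (cases "c i = 0")
      case True
      then show ?thesis using \<open>0 < L c0\<close> by simp
    next
      case False
      let ?s = "\<Sum>i\<in>J. \<bar>c i\<bar>"
      have s: "0 < ?s" by (rule sum_pos2[OF J i]) (use False in auto)
      have "L c0 \<le> L (\<lambda>i. inverse ?s * c i)" by (intro c0(2) normalise c s)
      also have "\<dots> = inverse ?s * L c" by (simp add: L_def sum_distrib_left mult_ac)
      finally have "?s \<le> inverse (L c0)" using s \<open>0 < L c0\<close> c by (simp add: field_simps)
      moreover have "\<bar>c i\<bar> \<le> ?s" by (rule member_le_sum) (use i J in auto)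
      ultimately show ?thesis by simp
    qed
    then show ?thesis using supp unfolding box_def by blast
  qed
  then obtain N where "{c \<in> P. L c = 1} = box N \<inter> (P \<inter> {c. L c = 1})" by blast
  then show ?thesis
    unfolding L_def[symmetric] using compact_Int_closed[OF cbox]
    by (simp add: P cL closed_Int closed_Collect_eq)
qed

section \<open>The two averages as positive linear functionals\<close>

lemma sets_surface_measure [measurable_cong, simp]: "sets (surface_measure :: (real ^ 'n) measure) = sets borel"
  unfolding surface_measure_def hausdorff_measure_def
  using sets.sigma_sets_eq[of "borel :: (real ^ 'n) measure"] by (simp add: sets_measure_of)

lemma space_surface_measure [simp]: "space surface_measure = UNIV"
  using sets_eq_imp_space_eq[OF sets_surface_measure] by simp

lemma real_polynomial_function_continuous_on:
  "real_polynomial_function U \<Longrightarrow> continuous_on A U"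
  by (simp add: continuous_at_imp_continuous_on continuous_real_polymonial_function)

lemma set_integrable_continuous_compact:
  fixes U :: "real ^ 'n \<Rightarrow> real"
  assumes A: "compact A" "emeasure M A < \<infinity>" "sets M = sets borel" and U: "continuous_on UNIV U"
  shows "set_integrable M A U"
proof -
  have "A \<in> sets M" using A by (simp add: compact_imp_closed)
  have "compact (U ` A)" by (intro compact_continuous_image continuous_on_subset[OF U] A) auto
  then obtain b where b: "\<And>x. x \<in> A \<Longrightarrow> norm (U x) \<le> b"
    using compact_imp_bounded by (metis bounded_iff imageI)
  show ?thesis unfolding set_integrable_def
  proof (rule integrableI_bounded_set_indicator[where B = b])
    show "U \<in> borel_measurable M"
      using borel_measurable_continuous_onI[OF U] by (simp cong: measurable_cong_sets add: A(3))
  qed (use A b \<open>A \<in> sets M\<close> in auto)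
qed

text \<open>
  On the line through \<open>x\<close> and a point of the open set, the polynomial becomes a polynomial in one
  variable with infinitely many zeros.
\<close>

lemma polynomial_zero_on_open:
  fixes U :: "real ^ 'n \<Rightarrow> real"
  assumes U: "real_polynomial_function U" and S: "open S" "S \<noteq> {}" "\<And>x. x \<in> S \<Longrightarrow> U x = 0"
  shows "U x = 0"
proof -
  obtain x0 where x0: "x0 \<in> S" using S by auto
  define f where "f t = x0 + t *\<^sub>R (x - x0)" for t :: real
  have "polynomial_function f" unfolding f_def
    by (intro polynomial_function_add polynomial_function_const polynomial_function_mult
        polynomial_function_bounded_linear bounded_linear_ident)
  then have "real_polynomial_function (U \<circ> f)" using U by (rule real_polynomial_function_compose)
  then obtain a n where an: "U \<circ> f = (\<lambda>t. \<Sum>i\<le>n. a i * t ^ i)"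
    using real_polynomial_function_iff_sum by blast
  have cf: "continuous_on UNIV f" unfolding f_def by (intro continuous_intros)
  have "open (f -` S)" using cf S(1) by (simp add: continuous_on_open_vimage)
  moreover have "0 \<in> f -` S" using x0 by (simp add: f_def)
  ultimately obtain e where e: "e > 0" "ball 0 e \<subseteq> f -` S" by (meson open_contains_ball)
  have "infinite (ball (0::real) e)" using e(1) by (simp add: ball_eq_greaterThanLessThan)
  moreover have "ball 0 e \<subseteq> {t. (\<Sum>i\<le>n. a i * t ^ i) = 0}"
  proof
    fix t :: real assume "t \<in> ball 0 e"
    then have "f t \<in> S" using e(2) by blast
    then show "t \<in> {t. (\<Sum>i\<le>n. a i * t ^ i) = 0}" using S(3)[of "f t"] fun_cong[OF an, of t] by simp
  qed
  ultimately have "infinite {t. (\<Sum>i\<le>n. a i * t ^ i) = 0}" using finite_subset by blast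
  then have "\<forall>i\<le>n. a i = 0" using polyfun_finite_roots by blast
  then have "(U \<circ> f) 1 = 0" unfolding an by simp
  then show ?thesis by (simp add: f_def)
qed

lemma mesh_cellD:
  assumes "mesh_cell K"
  shows "compact K" "interior K \<noteq> {}" "emeasure lborel K < \<infinity>" "0 < measure lborel K"
    "compact (frontier K)" "frontier K \<subseteq> K" "emeasure surface_measure (frontier K) < \<infinity>"
    "0 < measure surface_measure (frontier K)"
proof -
  show K: "compact K" "interior K \<noteq> {}" and fin: "emeasure surface_measure (frontier K) < \<infinity>"
    using assms by (auto simp: mesh_cell_def)
  show lf: "emeasure lborel K < \<infinity>" using K using emeasure_compact_finite[of K] by simp
  have "\<not> negligible K"
    using open_not_negligible[OF open_interior K(2)] negligible_subset[OF _ interior_subset] by blast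
  then have "K \<notin> null_sets lborel"
    using null_sets_completionI negligible_iff_null_sets by blast
  then have "emeasure lborel K \<noteq> 0" using K(1) by (auto simp: null_sets_def borel_compact)
  then show "0 < measure lborel K"
    using lf by (simp add: measure_def enn2real_positive_iff zero_less_iff_neq_zero)
  show "compact (frontier K)" using K by (simp add: compact_frontier)
  show "frontier K \<subseteq> K" using K by (simp add: compact_imp_closed frontier_subset_closed)
  show "0 < measure surface_measure (frontier K)"
    using assms fin by (simp add: mesh_cell_def measure_def enn2real_positive_iff)
qed

lemma
  fixes U :: "real ^ 'n \<Rightarrow> real"
  assumes K: "mesh_cell K" and U: "continuous_on UNIV U"
  shows set_integrable_cell: "set_integrable lborel K U"
    and set_integrable_bdry: "set_integrable surface_measure (frontier K) U"
proof -
  show "set_integrable lborel K U"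
    by (rule set_integrable_continuous_compact) (use mesh_cellD[OF K] U in simp_all)
  show "set_integrable surface_measure (frontier K) U"
    by (rule set_integrable_continuous_compact) (use mesh_cellD[OF K] U in simp_all)
qed

lemma
  assumes K: "mesh_cell K" and U: "continuous_on UNIV U" "continuous_on UNIV V"
  shows cell_avg_add: "cell_avg K (\<lambda>x. U x + V x) = cell_avg K U + cell_avg K V"
    and bdry_avg_add: "bdry_avg K (\<lambda>x. U x + V x) = bdry_avg K U + bdry_avg K V"
  unfolding cell_avg_def bdry_avg_def
  by (simp_all add: set_integral_add set_integrable_cell[OF K] set_integrable_bdry[OF K] U add_divide_distrib)

lemma cell_avg_scale: "cell_avg K (\<lambda>x. c * U x) = c * cell_avg K U"
  and bdry_avg_scale: "bdry_avg K (\<lambda>x. c * U x) = c * bdry_avg K U"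
  by (simp_all add: cell_avg_def bdry_avg_def)

lemma
  assumes K: "mesh_cell K"
  shows cell_avg_const: "cell_avg K (\<lambda>_. c) = c" and bdry_avg_const: "bdry_avg K (\<lambda>_. c) = c"
  unfolding cell_avg_def bdry_avg_def
  using mesh_cellD[OF K] by (simp_all add: set_lebesgue_integral_def less_top[symmetric] measure_def)

lemma
  assumes K: "mesh_cell K" and J: "finite J" and b: "\<And>i. i \<in> J \<Longrightarrow> continuous_on UNIV (b i)"
  shows cell_avg_sum: "cell_avg K (\<lambda>x. \<Sum>i\<in>J. c i * b i x) = (\<Sum>i\<in>J. c i * cell_avg K (b i))"
    and bdry_avg_sum: "bdry_avg K (\<lambda>x. \<Sum>i\<in>J. c i * b i x) = (\<Sum>i\<in>J. c i * bdry_avg K (b i))"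
  using J b
  by (induction J rule: finite_induct)
    (simp_all add: cell_avg_const[OF K] bdry_avg_const[OF K] cell_avg_add[OF K] bdry_avg_add[OF K]
      cell_avg_scale bdry_avg_scale continuous_on_sum continuous_on_mult_left)

lemma cell_avg_nonneg: "(\<And>x. x \<in> K \<Longrightarrow> 0 \<le> U x) \<Longrightarrow> 0 \<le> cell_avg K U"
  unfolding cell_avg_def set_lebesgue_integral_def
  by (intro divide_nonneg_nonneg integral_nonneg) (auto simp: indicator_def)

text \<open>
  A nonnegative function with zero integral vanishes almost everywhere, and a nonempty open set is not
  negligible.
\<close>

lemma cell_avg_pos:
  assumes K: "mesh_cell K" and U: "continuous_on UNIV U" "\<And>x. x \<in> K \<Longrightarrow> 0 \<le> U x"
    and x: "x \<in> interior K" "U x \<noteq> 0"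
  shows "0 < cell_avg K U"
proof (rule ccontr)
  assume "\<not> 0 < cell_avg K U"
  then have "cell_avg K U = 0" using cell_avg_nonneg[of K U] U by fastforce
  then have "(LINT x:K|lborel. U x) = 0" using mesh_cellD(4)[OF K] by (simp add: cell_avg_def)
  then have "AE x in lborel. indicator K x *\<^sub>R U x = 0"
    unfolding set_lebesgue_integral_def using set_integrable_cell[OF K U(1)] U(2)
    by (subst (asm) integral_nonneg_eq_0_iff_AE) (auto simp: set_integrable_def indicator_def)
  moreover define S where "S = interior K \<inter> U -` (-{0})"
  moreover have "open (U -` (-{0}))" using U(1) by (simp add: continuous_on_open_vimage open_Compl)
  then have oS: "open S" unfolding S_def by auto
  ultimately have "AE x in lborel. x \<notin> S"
    using interior_subset[of K] by (auto elim!: eventually_mono)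
  then have "S \<in> null_sets lborel"
    using oS by (subst (asm) AE_iff_null_sets[symmetric]) auto
  then have "negligible S" by (simp add: negligible_iff_null_sets null_sets_completionI)
  then have "S = {}" using oS open_not_negligible by blast
  then show False using x by (auto simp: S_def)
qed

section \<open>Invariance of the averages under isometries\<close>

lemma isometry_imp_bij:
  fixes g :: "real ^ 'n \<Rightarrow> real ^ 'n"
  assumes g: "\<And>x y. dist (g x) (g y) = dist x y"
  shows "bij g"
proof -
  have o: "orthogonal_transformation (\<lambda>x. g x - g 0)"
    unfolding orthogonal_transformation_isometry using g by (simp add: dist_norm)
  then have "bij (\<lambda>x. g x - g 0)" by (rule orthogonal_transformation_bij)
  then have "bij ((\<lambda>x. x + g 0) \<circ> (\<lambda>x. g x - g 0))" 
    by (rule bij_comp) (simp add: bij_plus_right)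
  then show ?thesis by (simp add: o_def)
qed

lemma isometry_continuous:
  assumes "\<And>x y. dist (g x) (g y) = dist x y" shows "continuous_on A g"
  unfolding continuous_on_iff using assms by auto

lemma nn_integral_lborel_shift:
  fixes F :: "'a::euclidean_space \<Rightarrow> ennreal"
  assumes "F \<in> borel_measurable borel" "\<bar>c\<bar> = 1"
  shows "(\<integral>\<^sup>+x. F (t + c *\<^sub>R x) \<partial>lborel) = (\<integral>\<^sup>+x. F x \<partial>lborel)"
proof -
  have "(\<integral>\<^sup>+x. F x \<partial>lborel) = (\<integral>\<^sup>+x. F x \<partial>density (distr lborel borel (\<lambda>x. t + c *\<^sub>R x)) (\<lambda>_. \<bar>c\<bar> ^ DIM('a)))"
    using assms(2) by (subst lborel_affine[of c t]) auto
  then show ?thesis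
    using assms by (simp add: nn_integral_density nn_integral_distr)
qed

text \<open>
  The preimage measure of an isometry is again translation invariant, so it is a multiple of Lebesgue
  measure; the factor is 1 because balls are mapped to balls.  The proportionality is the usual
  Fubini argument for the uniqueness of Haar measure: evaluating a double integral in two ways gives
  the symmetric relation \<open>swap\<close>.
\<close>

lemma lborel_isometry_invariant:
  fixes g :: "real ^ 'n \<Rightarrow> real ^ 'n"
  assumes g: "\<And>x y. dist (g x) (g y) = dist x y"
  shows "distr lborel borel g = lborel"
proof (rule measure_eqI)
  define f where "f x = g x - g 0" for x
  have f: "orthogonal_transformation f"
    unfolding orthogonal_transformation_isometry using g by (simp add: f_def dist_norm)
  then have lin: "linear f" and bf: "bij f"
    by (auto intro: orthogonal_transformation_linear orthogonal_transformation_bij)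
  \<comment> \<open>A translation of the argument by \<open>inv f (- y)\<close> translates the value by \<open>- y\<close>.\<close>
  have gt: "g (inv f (- y) + x) = g x - y" for x y
  proof -
    have "f (inv f (- y) + x) = f x - y"
      using bf by (simp add: linear_add[OF lin] bij_is_surj surj_f_inv_f)
    then show ?thesis by (simp add: f_def)
  qed
  have meas [measurable]: "g \<in> borel_measurable borel"
    by (rule borel_measurable_continuous_onI[OF isometry_continuous[OF g]])
  have swap: "emeasure lborel (g -` A) * emeasure lborel B = emeasure lborel (g -` B) * emeasure lborel A"
    if [measurable]: "A \<in> sets borel" "B \<in> sets borel" for A B :: "(real ^ 'n) set"
  proof -
    have pre [measurable]: "g -` A \<in> sets borel" "g -` B \<in> sets borel"
      using measurable_sets[OF meas] that by auto
    have "emeasure lborel (g -` A) * emeasure lborel B =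
        (\<integral>\<^sup>+x. \<integral>\<^sup>+y. indicator A (g x) * indicator B y \<partial>lborel \<partial>lborel)"
      by (simp add: nn_integral_cmult nn_integral_multc flip: indicator_vimage)
    also have "\<dots> = (\<integral>\<^sup>+x. \<integral>\<^sup>+y. indicator A (g x) * indicator B (g x + 1 *\<^sub>R y) \<partial>lborel \<partial>lborel)"
      by (intro nn_integral_cong nn_integral_lborel_shift[symmetric]) auto
    also have "\<dots> = (\<integral>\<^sup>+y. \<integral>\<^sup>+x. indicator A (g x) * indicator B (g x + 1 *\<^sub>R y) \<partial>lborel \<partial>lborel)"
      by (rule lborel_pair.Fubini') measurable
    also have "\<dots> = (\<integral>\<^sup>+y. \<integral>\<^sup>+x. indicator A (g (inv f (- y) + 1 *\<^sub>R x)) *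
        indicator B (g (inv f (- y) + 1 *\<^sub>R x) + 1 *\<^sub>R y) \<partial>lborel \<partial>lborel)"
      by (intro nn_integral_cong nn_integral_lborel_shift[symmetric]) measurable
    also have "\<dots> = (\<integral>\<^sup>+y. \<integral>\<^sup>+x. indicator A (g x + (-1) *\<^sub>R y) * indicator B (g x) \<partial>lborel \<partial>lborel)"
      by (simp add: gt)
    also have "\<dots> = (\<integral>\<^sup>+x. \<integral>\<^sup>+y. indicator A (g x + (-1) *\<^sub>R y) * indicator B (g x) \<partial>lborel \<partial>lborel)"
      by (rule lborel_pair.Fubini') measurable
    also have "\<dots> = (\<integral>\<^sup>+x. \<integral>\<^sup>+y. indicator A y * indicator B (g x) \<partial>lborel \<partial>lborel)"
      by (intro nn_integral_cong nn_integral_lborel_shift) auto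
    also have "\<dots> = emeasure lborel (g -` B) * emeasure lborel A"
      by (simp add: nn_integral_cmult nn_integral_multc mult.commute flip: indicator_vimage)
    finally show ?thesis .
  qed
  fix A assume "A \<in> sets (distr lborel borel g)"
  then have A: "A \<in> sets borel" by simp
  have "g -` ball (g 0) 1 = ball 0 1" using g[of 0] by (auto simp: dist_commute)
  moreover have "emeasure lborel (ball (g 0) 1) = emeasure lborel (ball (0 :: real ^ 'n) 1)"
    by (simp add: emeasure_ball)
  ultimately have "emeasure lborel (ball (0 :: real ^ 'n) 1) * emeasure lborel (g -` A) =
      emeasure lborel (ball (0 :: real ^ 'n) 1) * emeasure lborel A"
    using swap[OF A, of "ball (g 0) 1"] by (metis borel_open mult.commute open_ball)
  moreover have "emeasure lborel (ball (0 :: real ^ 'n) 1) \<noteq> 0" "emeasure lborel (ball (0 :: real ^ 'n) 1) \<noteq> \<infinity>"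
    using less_imp_neq[OF unit_ball_vol_pos[of "real CARD('n)"]] by (simp_all add: emeasure_ball)
  ultimately show "emeasure (distr lborel borel g) A = emeasure lborel A"
    using A by (simp add: emeasure_distr ennreal_mult_cancel_left)
qed simp

text \<open>
  The image of a cover is a cover of the image by sets of the same diameters.
\<close>

lemma hausdorff_outer_isometry_le:
  fixes g :: "'a::metric_space \<Rightarrow> 'a"
  assumes g: "\<And>x y. dist (g x) (g y) = dist x y"
  shows "hausdorff_outer d (g ` A) \<le> hausdorff_outer d A"
proof -
  have diam: "diameter (g ` C) = diameter C" for C
  proof -
    have "g ` C \<times> g ` C = (\<lambda>p. (g (fst p), g (snd p))) ` (C \<times> C)" by force
    then have "(\<lambda>(x, y). dist x y) ` (g ` C \<times> g ` C) = (\<lambda>(x, y). dist x y) ` (C \<times> C)"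
      by (simp add: image_image case_prod_unfold g)
    then show ?thesis by (simp add: diameter_def)
  qed
  have weight: "hausdorff_weight d (g ` C) = hausdorff_weight d C" for C
    by (cases "C = {}") (simp_all add: hausdorff_weight_def diam)
  have bdd: "bounded (g ` C)" if "bounded C" for C
    using that g unfolding bounded_two_points by auto
  have "hausdorff_pre d e (g ` A) \<le> hausdorff_pre d e A" for e
    unfolding hausdorff_pre_def[of d e A]
  proof (rule INF_greatest)
    fix C :: "nat \<Rightarrow> 'a set"
    assume "C \<in> {C. A \<subseteq> (\<Union>i. C i) \<and> (\<forall>i. bounded (C i) \<and> diameter (C i) \<le> e)}"
    then have "hausdorff_pre d e (g ` A) \<le> (\<Sum>i. hausdorff_weight d (g ` C i))"
      by (intro hausdorff_pre_le) (auto simp: diam bdd image_UN[symmetric] intro!: image_mono)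
    also have "\<dots> = (\<Sum>i. hausdorff_weight d (C i))"
      by (simp add: weight)
    finally show "hausdorff_pre d e (g ` A) \<le> (\<Sum>i. hausdorff_weight d (C i))" .
  qed
  then show ?thesis unfolding hausdorff_outer_def by (intro SUP_mono) auto
qed

lemma surface_measure_isometry_invariant:
  fixes g :: "real ^ 'n \<Rightarrow> real ^ 'n"
  assumes g: "\<And>x y. dist (g x) (g y) = dist x y"
  shows "distr surface_measure borel g = surface_measure"
proof (rule measure_eqI)
  fix A assume "A \<in> sets (distr (surface_measure :: (real ^ 'n) measure) borel g)"
  then have A: "A \<in> sets borel" by simp
  have bij: "bij g" by (rule isometry_imp_bij[OF g])
  have cg: "continuous_on UNIV g" by (rule isometry_continuous[OF g])
  have meas: "g \<in> measurable surface_measure borel"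
    using borel_measurable_continuous_onI[OF cg] by (simp add: measurable_def)
  have inv: "dist (inv g x) (inv g y) = dist x y" for x y
    using g[of "inv g x" "inv g y"] bij by (simp add: bij_is_surj surj_f_inv_f)
  have pre: "g -` A \<in> sets borel"
    using measurable_sets[OF borel_measurable_continuous_onI[OF cg] A] by simp
  have "hausdorff_outer (CARD('n) - 1) (g -` A) = hausdorff_outer (CARD('n) - 1) A"
  proof (rule antisym)
    show "hausdorff_outer (CARD('n) - 1) (g -` A) \<le> hausdorff_outer (CARD('n) - 1) A"
      using hausdorff_outer_isometry_le[of "inv g" _ A] inv by (simp add: bij_vimage_eq_inv_image[OF bij])
    have "g ` (g -` A) = A" using bij by (simp add: bij_is_surj)
    then show "hausdorff_outer (CARD('n) - 1) A \<le> hausdorff_outer (CARD('n) - 1) (g -` A)"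
      using hausdorff_outer_isometry_le[of g _ "g -` A"] g by simp
  qed
  then have "emeasure surface_measure (g -` A) = emeasure surface_measure A"
    using A pre by (simp add: surface_measure_def emeasure_hausdorff_measure)
  then show "emeasure (distr surface_measure borel g) A = emeasure surface_measure A"
    unfolding emeasure_distr[OF meas A] by simp
qed simp

lemma set_integral_isometry_invariant:
  fixes U :: "real ^ 'n \<Rightarrow> real"
  assumes M: "sets M = sets borel" "distr M borel g = M" and g: "g \<in> borel_measurable borel"
    and A: "A \<in> sets borel" "\<And>x. g x \<in> A \<longleftrightarrow> x \<in> A" and U: "U \<in> borel_measurable borel"
  shows "(LINT x:A|M. U (g x)) = (LINT x:A|M. U x)"
proof -
  let ?F = "\<lambda>x. indicator A x *\<^sub>R U x"
  have gM: "g \<in> measurable M borel" using g M(1) by (simp cong: measurable_cong_sets)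
  have F: "?F \<in> borel_measurable borel" using A U by simp
  have "(LINT x:A|M. U (g x)) = (LINT x|M. ?F (g x))"
    unfolding set_lebesgue_integral_def by (intro Bochner_Integration.integral_cong) (auto simp: A(2) indicator_def)
  also have "\<dots> = (LINT x|distr M borel g. ?F x)" using gM F by (rule integral_distr[symmetric])
  finally show ?thesis by (simp add: M(2) set_lebesgue_integral_def)
qed

lemma cell_isometriesD:
  assumes "g \<in> cell_isometries K"
  shows "dist (g x) (g y) = dist x y" "bij g" "g x \<in> K \<longleftrightarrow> x \<in> K" "g x \<in> frontier K \<longleftrightarrow> x \<in> frontier K"
    "g \<in> borel_measurable borel"
proof -
  have g: "\<And>x y. dist (g x) (g y) = dist x y" and gK: "g ` K = K"
    using assms by (auto simp: cell_isometries_def)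
  show "dist (g x) (g y) = dist x y" for x y by (rule g)
  show bij: "bij g" by (rule isometry_imp_bij[OF g])
  show mem: "g x \<in> K \<longleftrightarrow> x \<in> K" for x
    using gK bij by (metis bij_is_inj inj_image_mem_iff)
  have surj: "(\<exists>y. P y) \<longleftrightarrow> (\<exists>y. P (g y))" for P using bij by (metis bij_pointE)
  show "g x \<in> frontier K \<longleftrightarrow> x \<in> frontier K" for x
    unfolding frontier_straddle mem_Collect_eq Bex_def
    by (subst surj, subst (2) surj) (simp add: mem g)
  show "g \<in> borel_measurable borel"
    by (intro borel_measurable_continuous_onI isometry_continuous g)
qed

lemma
  assumes K: "compact K" and g: "g \<in> cell_isometries K" and U: "continuous_on UNIV U"
  shows cell_avg_isometry: "cell_avg K (U \<circ> g) = cell_avg K U"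
    and bdry_avg_isometry: "bdry_avg K (U \<circ> g) = bdry_avg K U"
proof -
  have U': "U \<in> borel_measurable borel" by (rule borel_measurable_continuous_onI[OF U])
  note inv = set_integral_isometry_invariant[OF _ _ cell_isometriesD(5)[OF g] _ _ U']
  have "K \<in> sets borel" "frontier K \<in> sets borel" using K by (auto simp: borel_compact compact_frontier)
  then show "cell_avg K (U \<circ> g) = cell_avg K U" "bdry_avg K (U \<circ> g) = bdry_avg K U"
    unfolding cell_avg_def bdry_avg_def o_def
    by (simp_all add: inv cell_isometriesD[OF g] lborel_isometry_invariant surface_measure_isometry_invariant)
qed

lemma id_cell_isometry: "id \<in> cell_isometries K"
  by (simp add: cell_isometries_def)

lemma comp_cell_isometry: "g \<in> cell_isometries K \<Longrightarrow> h \<in> cell_isometries K \<Longrightarrow> g \<circ> h \<in> cell_isometries K"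
  using image_comp[of g h K] by (simp add: cell_isometries_def)

lemma inv_cell_isometry:
  assumes g: "g \<in> cell_isometries K" shows "inv g \<in> cell_isometries K"
proof -
  have bij: "bij g" by (rule cell_isometriesD(2)[OF g])
  have "dist (inv g x) (inv g y) = dist x y" for x y
    using cell_isometriesD(1)[OF g, of "inv g x" "inv g y"] bij by (simp add: bij_is_surj surj_f_inv_f)
  moreover have "inv g ` (g ` K) = K" using bij by (simp add: bij_is_inj image_inv_f_f)
  then have "inv g ` K = K" using g by (simp add: cell_isometries_def)
  ultimately show ?thesis by (simp add: cell_isometries_def)
qed

section \<open>Nonnegative polynomials, optimizers and the bracket\<close>

text \<open>
  A cell together with a polynomial space given by a basis \<open>B\<close>.  The dimension of the space is not
  bounded by anything in the types, so coordinates of a polynomial are functions that vanish off \<open>B\<close>,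
  with the product topology, rather than vectors of a Euclidean space.
\<close>

locale cell_polynomials =
  fixes K :: "(real ^ 'n) set" and V B :: "(real ^ 'n \<Rightarrow> real) set"
  assumes cell: "mesh_cell K"
    and poly: "\<And>U. U \<in> V \<Longrightarrow> real_polynomial_function U"
    and fin: "finite B"
    and span: "\<And>U. U \<in> V \<longleftrightarrow> (\<exists>c. U = (\<lambda>x. \<Sum>b\<in>B. c b * b x))"
    and indep: "\<And>c b. (\<And>x. (\<Sum>b\<in>B. c b * b x) = 0) \<Longrightarrow> b \<in> B \<Longrightarrow> c b = 0"
    and one: "(\<lambda>_. 1) \<in> V"
begin

lemma comb_in_V: "(\<lambda>x. \<Sum>b\<in>B. c b * b x) \<in> V"
  unfolding span by blast

lemma V_add: assumes "U \<in> V" "U' \<in> V" shows "(\<lambda>x. U x + U' x) \<in> V"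
proof -
  obtain c c' where "U = (\<lambda>x. \<Sum>b\<in>B. c b * b x)" "U' = (\<lambda>x. \<Sum>b\<in>B. c' b * b x)"
    using assms by (auto simp: span)
  then have eq: "(\<lambda>x. U x + U' x) = (\<lambda>x. \<Sum>b\<in>B. (c b + c' b) * b x)"
    by (simp add: distrib_right sum.distrib)
  show ?thesis unfolding eq by (rule comb_in_V)
qed

lemma V_scale: assumes "U \<in> V" shows "(\<lambda>x. t * U x) \<in> V"
proof -
  obtain c where "U = (\<lambda>x. \<Sum>b\<in>B. c b * b x)"
    using assms by (auto simp: span)
  then have eq: "(\<lambda>x. t * U x) = (\<lambda>x. \<Sum>b\<in>B. (t * c b) * b x)"
    by (simp add: sum_distrib_left mult.assoc)
  show ?thesis unfolding eq by (rule comb_in_V)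
qed

lemma V_const: "(\<lambda>_. t) \<in> V" using V_scale[OF one, of t] by simp

lemma V_diff_const: "U \<in> V \<Longrightarrow> (\<lambda>x. U x - t) \<in> V"
  using V_add[OF _ V_const, of U "- t"] by simp

lemma V_continuous: "U \<in> V \<Longrightarrow> continuous_on A U"
  by (rule real_polynomial_function_continuous_on[OF poly])

lemma V_basis: "b \<in> B \<Longrightarrow> b \<in> V"
proof -
  assume b: "b \<in> B"
  have eq: "(\<lambda>x. \<Sum>b'\<in>B. (if b' = b then 1 else 0) * b' x) = b"
    using b fin by (simp add: if_distrib[of "\<lambda>t. t * _"] sum.delta cong: if_cong)
  show ?thesis using comb_in_V[of "\<lambda>b'. if b' = b then 1 else 0"] unfolding eq .
qed

definition nonneg_cone where "nonneg_cone = {U \<in> V. \<forall>x\<in>K. 0 \<le> U x}"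

lemma avg_diff_const:
  assumes "U \<in> V"
  shows "cell_avg K (\<lambda>x. U x - t) = cell_avg K U - t" "bdry_avg K (\<lambda>x. U x - t) = bdry_avg K U - t"
  using cell_avg_add[OF cell V_continuous[OF assms] continuous_on_const, of "- t"]
    bdry_avg_add[OF cell V_continuous[OF assms] continuous_on_const, of "- t"]
  by (simp_all add: cell_avg_const[OF cell] bdry_avg_const[OF cell])

lemma avg_comb:
  "cell_avg K (\<lambda>x. \<Sum>b\<in>B. c b * b x) = (\<Sum>b\<in>B. c b * cell_avg K b)"
  "bdry_avg K (\<lambda>x. \<Sum>b\<in>B. c b * b x) = (\<Sum>b\<in>B. c b * bdry_avg K b)"
  by (simp_all add: cell_avg_sum[OF cell fin] bdry_avg_sum[OF cell fin] V_continuous V_basis)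

lemma interior_nonzero:
  assumes "real_polynomial_function U" "U x \<noteq> 0"
  obtains y where "y \<in> interior K" "U y \<noteq> 0"
  using polynomial_zero_on_open[OF assms(1) open_interior mesh_cellD(2)[OF cell]] assms(2) by blast

text \<open>
  A nonzero polynomial is nonzero somewhere in the interior of the cell, where it contributes to the
  average.
\<close>

lemma cone_cell_avg_pos: assumes "U \<in> nonneg_cone" "U x \<noteq> 0" shows "0 < cell_avg K U"
proof -
  have U: "U \<in> V" "\<And>x. x \<in> K \<Longrightarrow> 0 \<le> U x" using assms by (auto simp: nonneg_cone_def)
  obtain y where "y \<in> interior K" "U y \<noteq> 0" using interior_nonzero[OF poly[OF U(1)] assms(2)] .
  then show ?thesis by (intro cell_avg_pos[OF cell V_continuous[OF U(1)] U(2)])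
qed

definition cone_coords where
  "cone_coords = {c. (\<forall>b. b \<notin> B \<longrightarrow> c b = 0) \<and> (\<forall>x\<in>K. 0 \<le> (\<Sum>b\<in>B. c b * b x))}"

definition base_coords where "base_coords = {c \<in> cone_coords. (\<Sum>b\<in>B. c b * cell_avg K b) = 1}"

lemma compact_base: "compact base_coords"
  unfolding base_coords_def
proof (rule compact_cone_base[OF _ fin])
  have eq: "cone_coords = (\<Inter>b\<in>- B. {c. c b = 0}) \<inter> (\<Inter>x\<in>K. {c. 0 \<le> (\<Sum>b\<in>B. c b * b x)})"
    by (auto simp: cone_coords_def)
  show "closed cone_coords"
    unfolding eq
    by (intro closed_Int closed_INT ballI closed_Collect_eq closed_Collect_le continuous_intros
        continuous_on_coordinate)
  show "c b = 0" if "c \<in> cone_coords" "b \<notin> B" for c b using that by (simp add: cone_coords_def)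
  show "(\<lambda>b. t * c b) \<in> cone_coords" if "c \<in> cone_coords" "0 \<le> t" for c t
    using that by (simp add: cone_coords_def mult.assoc sum_distrib_left[symmetric])
  show "0 < (\<Sum>b\<in>B. c b * cell_avg K b)" if c: "c \<in> cone_coords" "c b \<noteq> 0" for c b
  proof -
    have "b \<in> B" using c by (auto simp: cone_coords_def)
    then obtain x where x: "(\<Sum>b\<in>B. c b * b x) \<noteq> 0" using indep c(2) by metis
    have "(\<lambda>x. \<Sum>b\<in>B. c b * b x) \<in> nonneg_cone" using c by (auto simp: nonneg_cone_def cone_coords_def comb_in_V)
    from cone_cell_avg_pos[OF this x] show ?thesis by (simp add: avg_comb)
  qed
qed

lemma base_imp_cone:
  assumes "c \<in> base_coords"
  shows "(\<lambda>x. \<Sum>b\<in>B. c b * b x) \<in> nonneg_cone" "cell_avg K (\<lambda>x. \<Sum>b\<in>B. c b * b x) = 1"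
  using assms by (auto simp: base_coords_def cone_coords_def nonneg_cone_def comb_in_V avg_comb)

lemma cone_imp_base:
  assumes "U \<in> nonneg_cone" "cell_avg K U = 1"
  obtains c where "c \<in> base_coords" "U = (\<lambda>x. \<Sum>b\<in>B. c b * b x)"
proof -
  obtain c where c: "U = (\<lambda>x. \<Sum>b\<in>B. c b * b x)" using assms by (auto simp: nonneg_cone_def span)
  define c' where "c' b = (if b \<in> B then c b else 0)" for b
  have c': "(\<Sum>b\<in>B. c' b * f b) = (\<Sum>b\<in>B. c b * f b)" for f by (intro sum.cong) (auto simp: c'_def)
  have "c' \<in> base_coords"
    using assms by (simp add: base_coords_def cone_coords_def c' nonneg_cone_def c avg_comb)
      (simp add: c'_def)
  then show ?thesis by (rule that) (simp add: c c')
qed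

lemma cone_scale: "U \<in> nonneg_cone \<Longrightarrow> 0 \<le> t \<Longrightarrow> (\<lambda>x. t * U x) \<in> nonneg_cone"
  by (simp add: nonneg_cone_def V_scale)

lemma cone_const: "0 \<le> t \<Longrightarrow> (\<lambda>_. t) \<in> nonneg_cone"
  by (simp add: nonneg_cone_def V_const)

lemma base_nonempty: "base_coords \<noteq> {}"
  using cone_imp_base[OF cone_const[of 1]] by (auto simp: cell_avg_const[OF cell])

text \<open>
  This is the compactness of the slice of average 1.  Damping uses it to bound the deviation of a
  polynomial from its average by that average.
\<close>

lemma cone_bound: "\<exists>N\<ge>0. \<forall>U\<in>nonneg_cone. \<forall>x\<in>K. U x \<le> N * cell_avg K U"
proof -
  have "compact (base_coords \<times> K)" using compact_base mesh_cellD(1)[OF cell] by (rule compact_Times)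
  moreover have "continuous_on (base_coords \<times> K) (\<lambda>p. \<Sum>b\<in>B. fst p b * b (snd p))"
  proof (intro continuous_on_sum continuous_on_mult)
    fix b assume "b \<in> B"
    show "continuous_on (base_coords \<times> K) (\<lambda>p. fst p b)"
      by (rule continuous_on_product_then_coordinatewise[OF continuous_on_fst[OF continuous_on_id]])
    show "continuous_on (base_coords \<times> K) (\<lambda>p. b (snd p))"
      by (rule continuous_on_compose2[OF V_continuous[OF V_basis[OF \<open>b \<in> B\<close>], of UNIV]])
        (rule continuous_on_snd continuous_on_id subset_UNIV)+
  qed
  ultimately have "bounded ((\<lambda>p. \<Sum>b\<in>B. fst p b * b (snd p)) ` (base_coords \<times> K))"
    by (intro compact_imp_bounded compact_continuous_image)
  then obtain N where N: "0 < N" "\<And>c x. c \<in> base_coords \<Longrightarrow> x \<in> K \<Longrightarrow> \<bar>\<Sum>b\<in>B. c b * b x\<bar> \<le> N"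
    unfolding bounded_pos by fastforce
  have "U x \<le> N * cell_avg K U" if U: "U \<in> nonneg_cone" and x: "x \<in> K" for U x
  proof (cases "U x = 0")
    case True
    then show ?thesis using N cell_avg_nonneg[of K U] U by (simp add: nonneg_cone_def)
  next
    case False
    with U have pos: "0 < cell_avg K U" by (rule cone_cell_avg_pos)
    have "(\<lambda>x. inverse (cell_avg K U) * U x) \<in> nonneg_cone" using U pos by (intro cone_scale) auto
    moreover have "cell_avg K (\<lambda>x. inverse (cell_avg K U) * U x) = 1" using pos by (simp add: cell_avg_scale)
    ultimately obtain c where "c \<in> base_coords" "(\<lambda>x. inverse (cell_avg K U) * U x) = (\<lambda>x. \<Sum>b\<in>B. c b * b x)"
      by (rule cone_imp_base)
    then have "inverse (cell_avg K U) * U x \<le> N" using N(2)[of c x] x by (metis abs_le_D1)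
    then show ?thesis using pos by (simp add: field_simps)
  qed
  with N(1) show ?thesis by (intro exI[of _ N]) auto
qed

lemma maximal_boundary_average:
  "\<exists>U\<in>nonneg_cone. cell_avg K U = 1 \<and> (\<forall>U'\<in>nonneg_cone. bdry_avg K U' \<le> bdry_avg K U * cell_avg K U')"
proof -
  have "continuous_on base_coords (\<lambda>c. \<Sum>b\<in>B. c b * bdry_avg K b)"
    by (intro continuous_intros continuous_on_coordinate)
  from continuous_attains_sup[OF compact_base base_nonempty this] obtain c0 where
    c0: "c0 \<in> base_coords" "\<And>c. c \<in> base_coords \<Longrightarrow> (\<Sum>b\<in>B. c b * bdry_avg K b) \<le> (\<Sum>b\<in>B. c0 b * bdry_avg K b)"
    by blast
  define U where "U = (\<lambda>x. \<Sum>b\<in>B. c0 b * b x)"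
  have "bdry_avg K U' \<le> bdry_avg K U * cell_avg K U'" if U': "U' \<in> nonneg_cone" for U'
  proof (cases "\<exists>x. U' x \<noteq> 0")
    case False
    then have "U' = (\<lambda>_. 0)" by auto
    then show ?thesis by (simp add: cell_avg_const[OF cell] bdry_avg_const[OF cell])
  next
    case True
    with U' have pos: "0 < cell_avg K U'" using cone_cell_avg_pos by blast
    have "(\<lambda>x. inverse (cell_avg K U') * U' x) \<in> nonneg_cone" using U' pos by (intro cone_scale) auto
    moreover have "cell_avg K (\<lambda>x. inverse (cell_avg K U') * U' x) = 1" using pos by (simp add: cell_avg_scale)
    ultimately obtain c where c: "c \<in> base_coords" "(\<lambda>x. inverse (cell_avg K U') * U' x) = (\<lambda>x. \<Sum>b\<in>B. c b * b x)"
      by (rule cone_imp_base)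
    have "inverse (cell_avg K U') * bdry_avg K U' \<le> bdry_avg K U"
      using c0(2)[OF c(1)] unfolding avg_comb(2)[symmetric] c(2)[symmetric] U_def[symmetric]
      by (simp add: bdry_avg_scale)
    then show ?thesis using pos by (simp add: field_simps)
  qed
  then show ?thesis using base_imp_cone[OF c0(1)] unfolding U_def by blast
qed

lemma pos_polys_iff: "U \<in> pos_polys K V \<longleftrightarrow> U \<in> nonneg_cone \<and> 0 < cell_avg K U"
  by (auto simp: pos_polys_def nonneg_cone_def)

text \<open>
  The supremum is a maximum over the compact slice, so it turns into a linear inequality on the whole
  cone, which is the form in which optimality is used below.
\<close>

lemma Mstar_attained: "\<exists>U\<in>nonneg_cone. cell_avg K U = 1 \<and> bdry_avg K U = Mstar K V"
  and cone_bdry_avg_le: "U \<in> nonneg_cone \<Longrightarrow> bdry_avg K U \<le> Mstar K V * cell_avg K U"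
proof -
  obtain U0 where U0: "U0 \<in> nonneg_cone" "cell_avg K U0 = 1"
    "\<And>U. U \<in> nonneg_cone \<Longrightarrow> bdry_avg K U \<le> bdry_avg K U0 * cell_avg K U"
    using maximal_boundary_average by blast
  have "Mstar K V = bdry_avg K U0"
    unfolding Mstar_def
  proof (rule cSup_eq_maximum)
    show "bdry_avg K U0 \<in> bdry_ratio K ` pos_polys K V"
      using U0 by (intro image_eqI[of _ _ U0]) (auto simp: bdry_ratio_def pos_polys_iff)
    fix r assume "r \<in> bdry_ratio K ` pos_polys K V"
    then show "r \<le> bdry_avg K U0"
      using U0(3) by (auto simp: bdry_ratio_def pos_polys_iff field_simps)
  qed
  then show "\<exists>U\<in>nonneg_cone. cell_avg K U = 1 \<and> bdry_avg K U = Mstar K V"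
    and "U \<in> nonneg_cone \<Longrightarrow> bdry_avg K U \<le> Mstar K V * cell_avg K U"
    using U0 by auto
qed

lemma Mstar_ge_1: "1 \<le> Mstar K V"
  using cone_bdry_avg_le[OF cone_const[of 1]] by (simp add: cell_avg_const[OF cell] bdry_avg_const[OF cell])

lemma optimizer_iff:
  "optimizer K V U \<longleftrightarrow> U \<in> nonneg_cone \<and> 0 < cell_avg K U \<and> bdry_avg K U = Mstar K V * cell_avg K U"
  by (auto simp: optimizer_def pos_polys_iff bdry_ratio_def field_simps)

lemma bracket:
  assumes "U \<in> pos_polys K V" "quadrature_rule K V X w W"
  shows "bdry_ratio K U \<le> Mstar K V" "Mstar K V \<le> inverse W"
proof -
  show "bdry_ratio K U \<le> Mstar K V"
    using assms(1) cone_bdry_avg_le[of U] by (simp add: pos_polys_iff bdry_ratio_def field_simps)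
  obtain U0 where U0: "U0 \<in> nonneg_cone" "cell_avg K U0 = 1" "bdry_avg K U0 = Mstar K V"
    using Mstar_attained by blast
  have q: "X \<subseteq> K" "\<And>x. x \<in> X \<Longrightarrow> 0 < w x" "0 < W"
    "cell_avg K U0 = (\<Sum>x\<in>X. w x * U0 x) + W * bdry_avg K U0"
    using assms(2) U0(1) unfolding quadrature_rule_def nonneg_cone_def by blast+
  have "0 \<le> (\<Sum>x\<in>X. w x * U0 x)"
    using q U0(1) by (intro sum_nonneg mult_nonneg_nonneg) (auto simp: nonneg_cone_def less_imp_le)
  then have "W * Mstar K V \<le> 1" using q(4) U0 by simp
  then show "Mstar K V \<le> inverse W" using q(3) by (simp add: field_simps)
qed

lemma retentional_nonneg_at_points:
  assumes "quadrature_rule K V X w (inverse M)" "U \<in> V" "\<And>x. x \<in> X \<Longrightarrow> 0 \<le> U x"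
  shows "0 \<le> retentional K M U"
proof -
  have "0 < inverse M" and q: "\<And>x. x \<in> X \<Longrightarrow> 0 < w x"
      "cell_avg K U = (\<Sum>x\<in>X. w x * U x) + inverse M * bdry_avg K U"
    using assms unfolding quadrature_rule_def by blast+
  then have "0 < M" by simp
  have "0 \<le> (\<Sum>x\<in>X. w x * U x)"
    using q(1) assms(3) by (intro sum_nonneg mult_nonneg_nonneg) (auto simp: less_imp_le)
  moreover have "retentional K M U = M * (\<Sum>x\<in>X. w x * U x)"
    using \<open>0 < M\<close> by (simp add: retentional_def q(2) algebra_simps)
  ultimately show ?thesis using \<open>0 < M\<close> by simp
qed

lemma positive_minus_const:
  assumes U: "U \<in> V" and pos: "\<And>x. x \<in> K \<Longrightarrow> 0 < U x"
  obtains e where "0 < e" "(\<lambda>x. U x - e) \<in> nonneg_cone"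
proof -
  have K: "compact K" "K \<noteq> {}" using mesh_cellD(1,2)[OF cell] interior_subset[of K] by auto
  obtain x0 where "x0 \<in> K" "\<And>x. x \<in> K \<Longrightarrow> U x0 \<le> U x"
    using continuous_attains_inf[OF K V_continuous[OF U]] by blast
  then show ?thesis using U pos V_diff_const[OF U] by (intro that[of "U x0"]) (auto simp: nonneg_cone_def)
qed

text \<open>
  If an optimizer were positive on the cell, a small constant could be subtracted from it.  Both
  averages of a constant agree, so this would increase the ratio whenever the maximum exceeds 1.
\<close>

lemma optimizer_has_zero:
  assumes U: "optimizer K V U" and M: "Mstar K V \<noteq> 1"
  shows "{x\<in>K. U x = 0} \<noteq> {}"
proof
  assume empty: "{x\<in>K. U x = 0} = {}"
  have "U \<in> V" "\<And>x. x \<in> K \<Longrightarrow> 0 < U x"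
    using U empty by (auto simp: optimizer_iff nonneg_cone_def less_le)
  then obtain e where e: "0 < e" "(\<lambda>x. U x - e) \<in> nonneg_cone" by (rule positive_minus_const) auto
  have "bdry_avg K (\<lambda>x. U x - e) \<le> Mstar K V * cell_avg K (\<lambda>x. U x - e)"
    by (rule cone_bdry_avg_le[OF e(2)])
  then have "Mstar K V * e \<le> e"
    using U by (simp add: avg_diff_const[OF \<open>U \<in> V\<close>] optimizer_iff right_diff_distrib)
  then show False using e(1) M Mstar_ge_1 by simp
qed

text \<open>
  Inserting the optimizer into the rule leaves a vanishing sum of nonnegative terms.
\<close>

lemma optimizer_zero_on_points:
  assumes U: "optimizer K V U" and q: "quadrature_rule K V X w (1 / Mstar K V)" and x: "x \<in> X"
  shows "x \<in> K \<and> U x = 0"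
proof -
  have M: "0 < Mstar K V" using Mstar_ge_1 by simp
  have X: "finite X" "X \<subseteq> K" "\<And>x. x \<in> X \<Longrightarrow> 0 < w x"
    and eq: "cell_avg K U = (\<Sum>x\<in>X. w x * U x) + 1 / Mstar K V * bdry_avg K U"
    using q U unfolding quadrature_rule_def optimizer_iff nonneg_cone_def by blast+
  have nn: "0 \<le> w x * U x" if "x \<in> X" for x
    using X U that by (intro mult_nonneg_nonneg) (auto simp: optimizer_iff nonneg_cone_def less_imp_le)
  have "1 / Mstar K V * bdry_avg K U = cell_avg K U" using U M by (simp add: optimizer_iff)
  then have "(\<Sum>x\<in>X. w x * U x) = 0" using eq by linarith
  then have "w x * U x = 0" using sum_nonneg_eq_0_iff[OF X(1) nn] x by simp
  then show ?thesis using X(2) X(3)[OF x] x by auto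
qed

end

section \<open>Optimal quadrature\<close>

lemma merge_repeated_points:
  fixes p :: "nat \<Rightarrow> 'a" and v :: "nat \<Rightarrow> real"
  assumes "\<And>k. k < n \<Longrightarrow> p k \<in> K" "\<And>k. k < n \<Longrightarrow> 0 \<le> v k"
  shows "\<exists>X w. finite X \<and> X \<subseteq> K \<and> (\<forall>x\<in>X. 0 < w x) \<and>
    (\<forall>U :: 'a \<Rightarrow> real. (\<Sum>x\<in>X. w x * U x) = (\<Sum>k<n. v k * U (p k)))"
proof -
  define J where "J = {k. k < n \<and> 0 < v k}"
  define w where "w x = sum v {k \<in> J. p k = x}" for x
  have J: "finite J" by (simp add: J_def)
  show ?thesis
  proof (intro exI conjI ballI allI)
    show "finite (p ` J)" "p ` J \<subseteq> K" using J assms(1) by (auto simp: J_def)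
    fix x assume "x \<in> p ` J"
    then have "{k \<in> J. p k = x} \<noteq> {}" by auto
    then show "0 < w x" unfolding w_def using J by (intro sum_pos) (auto simp: J_def)
  next
    fix U :: "'a \<Rightarrow> real"
    have "(\<Sum>k<n. v k * U (p k)) = (\<Sum>k\<in>J. v k * U (p k))"
      using assms(2) by (intro sum.mono_neutral_right) (auto simp: J_def order.order_iff_strict)
    also have "\<dots> = (\<Sum>x\<in>p ` J. \<Sum>k\<in>{k \<in> J. p k = x}. v k * U (p k))"
      by (rule sum.image_gen[OF J])
    also have "\<dots> = (\<Sum>x\<in>p ` J. w x * U x)"
      by (simp add: w_def sum_distrib_right)
    finally show "(\<Sum>x\<in>p ` J. w x * U x) = (\<Sum>k<n. v k * U (p k))" by simp
  qed
qed

context cell_polynomials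
begin

text \<open>
  A nonnegative functional that vanishes at 1 vanishes altogether, since every polynomial is bounded
  on the cell.  Otherwise let \<open>s\<close> be its value at 1, and shift each point evaluation by \<open>l / s\<close>.  If some
  combination \<open>c\<close> of coordinates were positive at all shifted evaluations, the corresponding polynomial
  \<open>U\<close> would exceed \<open>l U / s\<close> on the cell, hence still after subtracting a small constant \<open>e\<close> from it; but
  \<open>l\<close> is \<open>- (e * s)\<close> at the difference.  So the origin is a convex combination of shifted
  evaluations, which is the representation divided by \<open>s\<close>.
\<close>

lemma nonneg_functional_representation:
  fixes l :: "(real ^ 'n \<Rightarrow> real) \<Rightarrow> real"
  assumes lin: "\<And>c. l (\<lambda>x. \<Sum>b\<in>B. c b * b x) = (\<Sum>b\<in>B. c b * l b)"
    and diff: "\<And>U t. U \<in> V \<Longrightarrow> l (\<lambda>x. U x - t) = l U - t * l (\<lambda>_. 1)"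
    and scale: "\<And>U t. U \<in> V \<Longrightarrow> l (\<lambda>x. t * U x) = t * l U"
    and nonneg: "\<And>U. U \<in> nonneg_cone \<Longrightarrow> 0 \<le> l U"
  shows "\<exists>X w. finite X \<and> X \<subseteq> K \<and> (\<forall>x\<in>X. 0 < w x) \<and> (\<forall>U\<in>V. l U = (\<Sum>x\<in>X. w x * U x))"
proof (cases "l (\<lambda>_. 1) = 0")
  case True
  have le: "l U \<le> 0" if U: "U \<in> V" for U
  proof -
    have "compact (U ` K)"
      using mesh_cellD(1)[OF cell] by (intro compact_continuous_image V_continuous U)
    then obtain t where t: "\<And>x. x \<in> K \<Longrightarrow> U x \<le> t"
      by (meson bounded_imp_bdd_above compact_imp_bounded bdd_above.E imageI)
    have "(\<lambda>x. (-1) * U x - (- t)) \<in> V" by (rule V_diff_const[OF V_scale[OF U]])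
    then have "(\<lambda>x. (-1) * U x - (- t)) \<in> nonneg_cone" using t by (simp add: nonneg_cone_def)
    then have "0 \<le> l (\<lambda>x. (-1) * U x - (- t))" by (rule nonneg)
    then show ?thesis unfolding diff[OF V_scale[OF U]] scale[OF U] True by simp
  qed
  have "l U = 0" if U: "U \<in> V" for U
    using le[OF U] le[OF V_scale[OF U, of "-1"]] unfolding scale[OF U] by simp
  then show ?thesis by (intro exI[of _ "{}"]) auto
next
  case False
  define s where "s = l (\<lambda>_. 1)"
  have s: "0 < s" using False nonneg[OF cone_const[of 1]] by (simp add: s_def)
  define \<phi> where "\<phi> x b = (if b \<in> B then b x - l b / s else 0)" for x b
  have c\<phi>: "continuous_on K \<phi>"
  proof (rule continuous_on_coordinatewise_then_product)
    show "continuous_on K (\<lambda>x. \<phi> x b)" for b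
      unfolding \<phi>_def using V_continuous[OF V_basis, of b K]
      by (cases "b \<in> B") (simp_all add: continuous_on_diff)
  qed
  have sum\<phi>: "(\<Sum>b\<in>B. c b * \<phi> x b) = (\<Sum>b\<in>B. c b * b x) - l (\<lambda>x. \<Sum>b\<in>B. c b * b x) / s" for c x
  proof -
    have "(\<Sum>b\<in>B. c b * \<phi> x b) = (\<Sum>b\<in>B. c b * b x - c b * l b / s)"
      by (intro sum.cong) (auto simp: \<phi>_def algebra_simps)
    then show ?thesis by (simp add: lin sum_subtractf sum_divide_distrib)
  qed
  have "\<exists>\<tau>\<in>\<phi> ` K. (\<Sum>b\<in>B. c b * \<tau> b) \<le> 0" for c
  proof (rule ccontr)
    assume no: "\<not> ?thesis"
    define U where "U = (\<lambda>x. \<Sum>b\<in>B. c b * b x)"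
    have UV: "U \<in> V" unfolding U_def by (rule comb_in_V)
    have pos: "0 < U x - l U / s" if "x \<in> K" for x
      using no that sum\<phi>[of c x] by (force simp: U_def)
    obtain e where e: "0 < e" "(\<lambda>x. U x - l U / s - e) \<in> nonneg_cone"
      using positive_minus_const[OF V_diff_const[OF UV] pos] .
    have "0 \<le> l (\<lambda>x. U x - l U / s - e)" by (rule nonneg[OF e(2)])
    also have "\<dots> = - (e * s)"
      unfolding diff[OF V_diff_const[OF UV]] diff[OF UV] s_def[symmetric] using s by simp
    finally show False using e(1) s by (simp add: mult_le_0_iff)
  qed
  from convex_combination_zero[OF fin compact_continuous_image[OF c\<phi> mesh_cellD(1)[OF cell]] this]
  obtain n :: nat and \<tau> v where v: "\<And>k. k < n \<Longrightarrow> \<tau> k \<in> \<phi> ` K" "\<And>k. k < n \<Longrightarrow> 0 \<le> v k" "(\<Sum>k<n. v k) = 1"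
    and zero: "\<And>b. b \<in> B \<Longrightarrow> (\<Sum>k<n. v k * \<tau> k b) = 0"
    by blast
  obtain p where p: "\<And>k. k < n \<Longrightarrow> p k \<in> K" "\<And>k. k < n \<Longrightarrow> \<tau> k = \<phi> (p k)"
    using v(1) unfolding image_iff by metis
  have sv: "0 \<le> s * v k" if "k < n" for k using v(2)[OF that] s by simp
  obtain X w where X: "finite X" "X \<subseteq> K" "\<And>x. x \<in> X \<Longrightarrow> 0 < w x"
    and w: "\<And>U :: real ^ 'n \<Rightarrow> real. (\<Sum>x\<in>X. w x * U x) = (\<Sum>k<n. s * v k * U (p k))"
    using merge_repeated_points[of n p K "\<lambda>k. s * v k", OF p(1) sv] by blast
  have rep: "l b = (\<Sum>k<n. s * v k * b (p k))" if b: "b \<in> B" for b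
  proof -
    have "0 = (\<Sum>k<n. v k * (b (p k) - l b / s))"
      using zero[OF b] p(2) b by (simp add: \<phi>_def)
    also have "\<dots> = (\<Sum>k<n. v k * b (p k)) - (\<Sum>k<n. v k) * (l b / s)"
      by (simp only: right_diff_distrib sum_subtractf sum_distrib_right)
    finally have "l b / s = (\<Sum>k<n. v k * b (p k))" using v(3) by simp
    then have "l b = s * (\<Sum>k<n. v k * b (p k))" using s by (simp add: field_simps)
    then show ?thesis by (simp add: sum_distrib_left mult.assoc)
  qed
  have "l U = (\<Sum>x\<in>X. w x * U x)" if "U \<in> V" for U
  proof -
    obtain c where c: "U = (\<lambda>x. \<Sum>b\<in>B. c b * b x)" using \<open>U \<in> V\<close> span by blast
    have "l U = (\<Sum>b\<in>B. c b * (\<Sum>k<n. s * v k * b (p k)))" by (simp add: c lin rep)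
    also have "\<dots> = (\<Sum>k<n. s * v k * U (p k))"
      unfolding c sum_distrib_left by (subst sum.swap) (simp add: mult_ac)
    finally show ?thesis by (simp add: w)
  qed
  with X show ?thesis by blast
qed

lemma optimal_quadrature_exists: "\<exists>X w. quadrature_rule K V X w (inverse (Mstar K V))"
proof -
  have M: "0 < Mstar K V" using Mstar_ge_1 by simp
  define l where "l U = cell_avg K U - inverse (Mstar K V) * bdry_avg K U" for U
  have "\<exists>X w. finite X \<and> X \<subseteq> K \<and> (\<forall>x\<in>X. 0 < w x) \<and> (\<forall>U\<in>V. l U = (\<Sum>x\<in>X. w x * U x))"
  proof (rule nonneg_functional_representation)
    show "l (\<lambda>x. \<Sum>b\<in>B. c b * b x) = (\<Sum>b\<in>B. c b * l b)" for c
      unfolding l_def avg_comb by (simp add: right_diff_distrib sum_subtractf sum_distrib_left mult_ac)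
    show "l (\<lambda>x. U x - t) = l U - t * l (\<lambda>_. 1)" if "U \<in> V" for U t
      by (simp add: l_def avg_diff_const[OF that] cell_avg_const[OF cell] bdry_avg_const[OF cell] algebra_simps)
    show "l (\<lambda>x. t * U x) = t * l U" for U t
      by (simp add: l_def cell_avg_scale bdry_avg_scale algebra_simps)
    show "0 \<le> l U" if "U \<in> nonneg_cone" for U
      using cone_bdry_avg_le[OF that] M by (simp add: l_def field_simps)
  qed
  then obtain X w where "finite X" "X \<subseteq> K" "\<forall>x\<in>X. 0 < w x" "\<forall>U\<in>V. l U = (\<Sum>x\<in>X. w x * U x)" by blast
  then have "quadrature_rule K V X w (inverse (Mstar K V))"
    unfolding quadrature_rule_def using M by (force simp: l_def)
  then show ?thesis by blast
qed

lemma optimizer_exists: "\<exists>U. optimizer K V U"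
  using Mstar_attained by (auto simp: optimizer_iff)

end

section \<open>Damping\<close>

context cell_polynomials
begin

lemma retentional_damp:
  assumes U: "U \<in> V"
  shows "retentional K M (damp K t U) = (M - 1) * cell_avg K U + t * (retentional K M U - (M - 1) * cell_avg K U)"
proof -
  define a where "a = cell_avg K U"
  have eq: "damp K t U = (\<lambda>x. t * U x - (t * a - a))"
    unfolding damp_def a_def[symmetric] by (simp add: algebra_simps)
  show ?thesis
    unfolding retentional_def eq avg_diff_const[OF V_scale[OF U]] cell_avg_scale bdry_avg_scale a_def[symmetric]
    by (simp add: algebra_simps)
qed

lemma nonneg_cone_shift:
  assumes "U \<in> V" "\<And>x. x \<in> K \<Longrightarrow> t \<le> U x" shows "(\<lambda>x. U x - t) \<in> nonneg_cone"
  using assms V_diff_const by (simp add: nonneg_cone_def)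

text \<open>
  The retentional is affine in the damping factor and, by the lower bound on \<open>U\<close>, its undamped value is
  at least \<open>- (M - 1) * e\<close>.  If damping is needed at all, the root of this affine function gives
  \<open>(1 - \<theta>) * a \<le> e\<close> for the cell average \<open>a\<close>: the removed portion of the deviation is small whenever
  the deviation may be large.
\<close>

lemma damping_factor_bounds:
  assumes U: "U \<in> V" and a: "0 \<le> cell_avg K U" and M: "Mstar K V \<le> M"
    and e: "0 \<le> e" and lower: "\<And>x. x \<in> K \<Longrightarrow> - e \<le> U x"
  shows "damping_factor K M U \<le> 1"
    and "(1 - damping_factor K M U) * (cell_avg K U + e) \<le> 2 * e"
proof -
  define a where "a = cell_avg K U"
  define r where "r = retentional K M U"
  have M1: "1 \<le> M" using M Mstar_ge_1 by simp
  have a0: "0 \<le> a" using assms(2) by (simp add: a_def)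
  have df: "damping_factor K M U = (GREATEST t. t \<in> {0..1} \<and> 0 \<le> (M - 1) * a + t * (r - (M - 1) * a))"
    by (simp add: damping_factor_def retentional_damp[OF U] a_def r_def)
  have "(\<lambda>x. U x - (- e)) \<in> nonneg_cone" by (rule nonneg_cone_shift[OF U lower])
  from cone_bdry_avg_le[OF this] have "bdry_avg K U + e \<le> Mstar K V * (a + e)"
    unfolding avg_diff_const[OF U] a_def by simp
  also have "\<dots> \<le> M * (a + e)" using M a0 e by (intro mult_right_mono) auto
  finally have r: "- r \<le> (M - 1) * e" by (simp add: r_def retentional_def a_def algebra_simps)
  have "damping_factor K M U \<le> 1 \<and> (1 - damping_factor K M U) * (a + e) \<le> 2 * e"
  proof (cases "0 \<le> r")
    case True
    have "damping_factor K M U = 1"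
      unfolding df using True by (intro Greatest_equality) auto
    then show ?thesis using e by simp
  next
    case False
    define s where "s = (M - 1) * a"
    have s: "0 \<le> s" using M1 a0 by (simp add: s_def)
    have rs: "0 < s - r" using False s by simp
    have le1: "s / (s - r) \<le> 1" "0 \<le> s / (s - r)" using s rs False by (simp_all add: divide_le_eq_1)
    have "s / (s - r) * (s - r) = s" using rs by simp
    then have root: "s / (s - r) * (r - s) = - s" by (metis minus_diff_eq mult_minus_right)
    have t: "damping_factor K M U = s / (s - r)"
      unfolding df s_def[symmetric]
    proof (rule Greatest_equality)
      show "s / (s - r) \<in> {0..1} \<and> 0 \<le> s + s / (s - r) * (r - s)"
        using le1 root by simp
      fix t assume "t \<in> {0..1} \<and> 0 \<le> s + t * (r - s)"
      then have "t * (s - r) \<le> s" by (simp add: algebra_simps)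
      then show "t \<le> s / (s - r)" using rs by (simp add: pos_le_divide_eq)
    qed
    have 1: "1 - s / (s - r) = - r / (s - r)"
      using diff_divide_distrib[of "s - r" s "s - r"] rs by simp
    have "(1 - s / (s - r)) * (a + e) \<le> 2 * e"
    proof (cases "a \<le> e")
      case True
      have "(1 - s / (s - r)) * (a + e) \<le> 1 * (a + e)"
        using le1 a0 e by (intro mult_right_mono) auto
      with True show ?thesis by simp
    next
      case ae: False
      have "M \<noteq> 1" using False r by auto
      with M1 have M1': "0 < M - 1" by simp
      have "- r * a \<le> (M - 1) * e * a" using r a0 by (rule mult_right_mono)
      also have "\<dots> = e * s" by (simp add: s_def)
      also have "\<dots> \<le> e * (s - r)" using e False by (intro mult_left_mono) auto
      finally have "(1 - s / (s - r)) * a \<le> e"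
        unfolding 1 by (simp only: times_divide_eq_left pos_divide_le_eq[OF rs])
      moreover have "(1 - s / (s - r)) * e \<le> (1 - s / (s - r)) * a"
        using le1 ae by (intro mult_left_mono) auto
      ultimately have "(1 - s / (s - r)) * a + (1 - s / (s - r)) * e \<le> e + e"
        by (meson add_mono order_trans)
      then show ?thesis by (simp only: distrib_left mult_2)
    qed
    with le1 show ?thesis by (simp add: t)
  qed
  then show "damping_factor K M U \<le> 1" "(1 - damping_factor K M U) * (cell_avg K U + e) \<le> 2 * e"
    by (simp_all add: a_def)
qed

text \<open>
  An error bound \<open>e\<close> makes \<open>U + e\<close> nonnegative on the cell, so the deviation of \<open>U\<close> from its average \<open>a\<close> is
  at most \<open>(N + 1) * (a + e)\<close>, where \<open>N\<close> compares the supremum with the cell average.  Damping removes the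
  fraction \<open>1 - \<theta>\<close> of it, and \<open>(1 - \<theta>) * (a + e) \<le> 2 * e\<close>.
\<close>

lemma damping_retains:
  assumes M: "Mstar K V \<le> M"
  shows "damping_retains_accuracy K V k M"
  unfolding damping_retains_accuracy_def sup_error_bigo_def
proof (intro allI impI)
  fix u U :: "real \<Rightarrow> real ^ 'n \<Rightarrow> real"
  assume u: "\<forall>\<delta>>0. \<forall>x\<in>K. 0 \<le> u \<delta> x" and U: "\<forall>\<delta>>0. U \<delta> \<in> V \<and> 0 \<le> cell_avg K (U \<delta>)"
  assume "\<exists>c. \<forall>\<^sub>F \<delta> in at_right 0. \<forall>x\<in>K. \<bar>U \<delta> x - u \<delta> x\<bar> \<le> c * \<delta> ^ (k + 1)"
  then obtain c where c: "\<forall>\<^sub>F \<delta> in at_right 0. \<forall>x\<in>K. \<bar>U \<delta> x - u \<delta> x\<bar> \<le> c * \<delta> ^ (k + 1)" by blast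
  obtain N where N: "0 \<le> N" "\<And>U x. U \<in> nonneg_cone \<Longrightarrow> x \<in> K \<Longrightarrow> U x \<le> N * cell_avg K U"
    using cone_bound by blast
  obtain x0 where x0: "x0 \<in> K" using mesh_cellD(2)[OF cell] interior_subset[of K] by auto
  have "\<forall>\<^sub>F \<delta> in at_right 0. \<forall>x\<in>K.
      \<bar>damp K (damping_factor K M (U \<delta>)) (U \<delta>) x - u \<delta> x\<bar> \<le> (c * (2 * N + 3)) * \<delta> ^ (k + 1)"
    using c eventually_at_right_less[of 0]
  proof eventually_elim
    case (elim \<delta>)
    define e where "e = c * \<delta> ^ (k + 1)"
    define t where "t = damping_factor K M (U \<delta>)"
    define a where "a = cell_avg K (U \<delta>)"
    have UV: "U \<delta> \<in> V" and a: "0 \<le> a" using U elim(2) by (auto simp: a_def)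
    have err: "\<bar>U \<delta> x - u \<delta> x\<bar> \<le> e" if "x \<in> K" for x using elim(1) that by (simp add: e_def)
    have e: "0 \<le> e" using err[OF x0] by simp
    have lower: "- e \<le> U \<delta> x" if "x \<in> K" for x
      using err[OF that] u elim(2) that by (smt (verit))
    have t: "t \<le> 1" "(1 - t) * (a + e) \<le> 2 * e"
      using damping_factor_bounds[OF UV _ M e lower] a by (simp_all add: t_def a_def)
    have shift: "(\<lambda>x. U \<delta> x - (- e)) \<in> nonneg_cone" by (rule nonneg_cone_shift[OF UV lower])
    show ?case
    proof
      fix x assume x: "x \<in> K"
      have up: "U \<delta> x + e \<le> N * (a + e)"
        using N(2)[OF shift x] unfolding avg_diff_const[OF UV] by (simp add: a_def)
      have Nae: "0 \<le> N * (a + e)" using N(1) a e by simp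
      have dev: "\<bar>U \<delta> x - a\<bar> \<le> (N + 1) * (a + e)"
        using up lower[OF x] a e Nae by (simp add: distrib_right abs_le_iff)
      have "\<bar>damp K t (U \<delta>) x - u \<delta> x\<bar> = \<bar>(U \<delta> x - u \<delta> x) - (1 - t) * (U \<delta> x - a)\<bar>"
        by (simp add: damp_def a_def algebra_simps)
      also have "\<dots> \<le> \<bar>U \<delta> x - u \<delta> x\<bar> + (1 - t) * \<bar>U \<delta> x - a\<bar>"
        using t(1) by (metis abs_mult abs_of_nonneg abs_triangle_ineq4 diff_ge_0_iff_ge)
      also have "\<dots> \<le> e + (1 - t) * ((N + 1) * (a + e))"
        using t(1) by (intro add_mono err x mult_left_mono dev) auto
      also have "\<dots> = e + (N + 1) * ((1 - t) * (a + e))" by simp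
      also have "\<dots> \<le> e + (N + 1) * (2 * e)"
        using N(1) by (intro add_left_mono mult_left_mono t) auto
      also have "\<dots> = (c * (2 * N + 3)) * \<delta> ^ (k + 1)" by (simp add: e_def algebra_simps)
      finally show "\<bar>damp K (damping_factor K M (U \<delta>)) (U \<delta>) x - u \<delta> x\<bar> \<le> (c * (2 * N + 3)) * \<delta> ^ (k + 1)"
        by (simp add: t_def)
    qed
  qed
  then show "\<exists>c. \<forall>\<^sub>F \<delta> in at_right 0. \<forall>x\<in>K.
      \<bar>damp K (damping_factor K M (U \<delta>)) (U \<delta>) x - u \<delta> x\<bar> \<le> c * \<delta> ^ (k + 1)" by blast
qed

end

section \<open>Invariant optimizers and rules\<close>

context cell_polynomials
begin

lemma cell_avg_square_comb:
  "cell_avg K (\<lambda>x. (\<Sum>b\<in>B. c b * b x)\<^sup>2) =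
    (\<Sum>q\<in>B \<times> B. (c (fst q) * c (snd q)) * cell_avg K (\<lambda>x. fst q x * snd q x))"
proof -
  have "(\<lambda>x. (\<Sum>b\<in>B. c b * b x)\<^sup>2) = (\<lambda>x. \<Sum>q\<in>B \<times> B. (c (fst q) * c (snd q)) * (fst q x * snd q x))"
    by (simp add: power2_eq_square sum_product sum.cartesian_product case_prod_unfold mult_ac)
  then show ?thesis
    using cell_avg_sum[OF cell, of "B \<times> B" "\<lambda>q x. fst q x * snd q x"] fin
    by (auto simp: continuous_on_mult V_continuous V_basis)
qed

lemma least_square_optimizer:
  "\<exists>U\<in>nonneg_cone. cell_avg K U = 1 \<and> bdry_avg K U = Mstar K V \<and>
    (\<forall>U'\<in>nonneg_cone. cell_avg K U' = 1 \<longrightarrow> bdry_avg K U' = Mstar K V \<longrightarrow>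
       cell_avg K (\<lambda>x. (U x)\<^sup>2) \<le> cell_avg K (\<lambda>x. (U' x)\<^sup>2))"
proof -
  define S where "S = base_coords \<inter> {c. (\<Sum>b\<in>B. c b * bdry_avg K b) = Mstar K V}"
  define q where "q c = cell_avg K (\<lambda>x. (\<Sum>b\<in>B. c b * b x)\<^sup>2)" for c
  have "compact S" unfolding S_def
    by (intro compact_Int_closed compact_base closed_Collect_eq continuous_on_sum continuous_on_mult
        continuous_on_const continuous_on_coordinate)
  moreover have "continuous_on S q"
    unfolding q_def cell_avg_square_comb
    by (intro continuous_on_sum continuous_on_mult continuous_on_const continuous_on_coordinate)
  moreover have in_S: "\<exists>c\<in>S. U = (\<lambda>x. \<Sum>b\<in>B. c b * b x)"
    if U: "U \<in> nonneg_cone" "cell_avg K U = 1" "bdry_avg K U = Mstar K V" for U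
  proof -
    obtain c where "c \<in> base_coords" "U = (\<lambda>x. \<Sum>b\<in>B. c b * b x)" using cone_imp_base[OF U(1,2)] .
    then show ?thesis using U(3) by (auto simp: S_def avg_comb)
  qed
  moreover have "S \<noteq> {}" using in_S Mstar_attained by blast
  ultimately obtain c0 where c0: "c0 \<in> S" "\<And>c. c \<in> S \<Longrightarrow> q c0 \<le> q c"
    using continuous_attains_inf[of S q] by blast
  define U where "U = (\<lambda>x. \<Sum>b\<in>B. c0 b * b x)"
  have "c0 \<in> base_coords" "bdry_avg K U = Mstar K V" using c0(1) by (auto simp: S_def U_def avg_comb)
  moreover have "cell_avg K (\<lambda>x. (U x)\<^sup>2) \<le> cell_avg K (\<lambda>x. (U' x)\<^sup>2)"
    if U': "U' \<in> nonneg_cone" "cell_avg K U' = 1" "bdry_avg K U' = Mstar K V" for U'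
  proof -
    obtain c where "c \<in> S" "U' = (\<lambda>x. \<Sum>b\<in>B. c b * b x)" using in_S[OF U'] by blast
    then show ?thesis using c0(2)[of c] by (simp add: q_def U_def)
  qed
  ultimately show ?thesis using base_imp_cone[of c0] unfolding U_def[symmetric] by blast
qed

text \<open>
  The isometry group may be infinite, so instead of averaging an optimizer over it one takes an
  optimizer of cell average 1 whose square has least cell average.  By the parallelogram identity this
  optimizer is unique, and its composition with an isometry of the cell has the same properties.
\<close>

lemma invariant_optimizer_exists:
  assumes inv: "invariant_space K V"
  shows "\<exists>U. optimizer K V U \<and> invariant_fun K U"
proof -
  obtain U where U: "U \<in> nonneg_cone" "cell_avg K U = 1" "bdry_avg K U = Mstar K V"
    and min: "\<And>U'. U' \<in> nonneg_cone \<Longrightarrow> cell_avg K U' = 1 \<Longrightarrow> bdry_avg K U' = Mstar K V \<Longrightarrow>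
      cell_avg K (\<lambda>x. (U x)\<^sup>2) \<le> cell_avg K (\<lambda>x. (U' x)\<^sup>2)"
    using least_square_optimizer by blast
  have UV: "U \<in> V" and Upos: "\<And>x. x \<in> K \<Longrightarrow> 0 \<le> U x" using U(1) by (auto simp: nonneg_cone_def)
  have cK: "compact K" by (rule mesh_cellD(1)[OF cell])
  have "U \<circ> g = U" if g: "g \<in> cell_isometries K" for g
  proof -
    define U' where "U' = U \<circ> g"
    have U'V: "U' \<in> V" using inv UV g by (auto simp: U'_def invariant_space_def)
    have avg': "cell_avg K U' = 1" "bdry_avg K U' = Mstar K V"
      unfolding U'_def using U by (simp_all add: cell_avg_isometry[OF cK g V_continuous[OF UV]]
          bdry_avg_isometry[OF cK g V_continuous[OF UV]])
    \<comment> \<open>The midpoint competes with \<open>U\<close>; by the parallelogram identity \<open>d\<close> has square average at most 0.\<close>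
    define m where "m = (\<lambda>x. 1 / 2 * (U x + U' x))"
    define d where "d = (\<lambda>x. U x + (-1) * U' x)"
    have mV: "m \<in> V" unfolding m_def by (intro V_scale V_add UV U'V)
    have dV: "d \<in> V" unfolding d_def by (intro V_scale V_add UV U'V)
    have "0 \<le> U' x" if "x \<in> K" for x
      using Upos cell_isometriesD(3)[OF g] that by (simp add: U'_def)
    then have mnn: "m \<in> nonneg_cone" using mV Upos by (simp add: nonneg_cone_def m_def)
    have mavg: "cell_avg K m = 1" "bdry_avg K m = Mstar K V"
      unfolding m_def cell_avg_scale bdry_avg_scale
        cell_avg_add[OF cell V_continuous[OF UV] V_continuous[OF U'V]]
        bdry_avg_add[OF cell V_continuous[OF UV] V_continuous[OF U'V]]
      using U avg' by simp_all
    have csq: "continuous_on UNIV (\<lambda>x. t * (W x)\<^sup>2)" if "W \<in> V" for W and t :: real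
      by (intro continuous_on_mult continuous_on_const continuous_on_power V_continuous that)
    have "cell_avg K (\<lambda>x. (U' x)\<^sup>2) = cell_avg K (\<lambda>x. (U x)\<^sup>2)"
      using cell_avg_isometry[OF cK g, of "\<lambda>x. (U x)\<^sup>2"] csq[OF UV, of 1] by (simp add: U'_def o_def)
    moreover have "4 * cell_avg K (\<lambda>x. (m x)\<^sup>2) + 1 * cell_avg K (\<lambda>x. (d x)\<^sup>2) =
        2 * cell_avg K (\<lambda>x. (U x)\<^sup>2) + 2 * cell_avg K (\<lambda>x. (U' x)\<^sup>2)"
    proof -
      have "(\<lambda>x. 4 * (m x)\<^sup>2 + 1 * (d x)\<^sup>2) = (\<lambda>x. 2 * (U x)\<^sup>2 + 2 * (U' x)\<^sup>2)"
        by (simp add: m_def d_def fun_eq_iff power2_eq_square field_simps)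
      then have "cell_avg K (\<lambda>x. 4 * (m x)\<^sup>2 + 1 * (d x)\<^sup>2) = cell_avg K (\<lambda>x. 2 * (U x)\<^sup>2 + 2 * (U' x)\<^sup>2)"
        by (rule arg_cong)
      then show ?thesis
        unfolding cell_avg_add[OF cell csq[OF mV] csq[OF dV]] cell_avg_add[OF cell csq[OF UV] csq[OF U'V]]
          cell_avg_scale .
    qed
    ultimately have d0: "cell_avg K (\<lambda>x. (d x)\<^sup>2) \<le> 0" using min[OF mnn mavg] by simp
    have "d x = 0" for x
    proof (rule ccontr)
      assume "d x \<noteq> 0"
      then obtain y where y: "y \<in> interior K" "d y \<noteq> 0" using interior_nonzero[OF poly[OF dV]] by blast
      have "0 < cell_avg K (\<lambda>x. (d x)\<^sup>2)"
        using csq[OF dV, of 1] y by (intro cell_avg_pos[OF cell _ _ y(1)]) auto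
      with d0 show False by simp
    qed
    then show ?thesis by (simp add: fun_eq_iff d_def U'_def)
  qed
  moreover have "optimizer K V U" using U by (simp add: optimizer_iff)
  ultimately show ?thesis unfolding invariant_fun_def by blast
qed

text \<open>
  Averaging the rule over the group gives the weight \<open>w'\<close>, supported on the orbits of the points of \<open>X\<close>.
  Invariance is a reindexing of the sum over the group, and correctness holds for each summand because
  both averages are preserved.
\<close>

lemma invariant_rule_exists:
  assumes q: "quadrature_rule K V X w W" and inv: "invariant_space K V" and fG: "finite (cell_isometries K)"
  shows "\<exists>X' w'. quadrature_rule K V X' w' W \<and> invariant_rule K X' w'"
proof -
  define G where "G = cell_isometries K"
  define v where "v x = (if x \<in> X then w x else 0)" for x
  define X' where "X' = (\<Union>g\<in>G. g ` X)"
  define w' where "w' y = (\<Sum>g\<in>G. v (g y)) / card G" for y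
  have G: "finite G" "id \<in> G" using fG by (auto simp: G_def id_cell_isometry)
  then have cG: "0 < card G" using card_gt_0_iff by blast
  have Gc: "\<And>g h. g \<in> G \<Longrightarrow> h \<in> G \<Longrightarrow> g \<circ> h \<in> G" and Gi: "\<And>g. g \<in> G \<Longrightarrow> inv g \<in> G"
    by (simp_all add: G_def comp_cell_isometry inv_cell_isometry)
  have bij: "bij g" if "g \<in> G" for g using that cell_isometriesD(2) by (auto simp: G_def)
  have invl: "inv g (g x) = x" and invr: "g (inv g x) = x" if "g \<in> G" for g x
    using bij[OF that] by (simp_all add: bij_is_inj bij_is_surj surj_f_inv_f)
  have X: "finite X" "X \<subseteq> K" "\<And>x. x \<in> X \<Longrightarrow> 0 < w x" "0 < W"
    and qU: "\<And>U. U \<in> V \<Longrightarrow> cell_avg K U = (\<Sum>x\<in>X. w x * U x) + W * bdry_avg K U"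
    using q unfolding quadrature_rule_def by blast+
  have fX': "finite X'" using G X by (simp add: X'_def)
  have XX': "X \<subseteq> X'" using G(2) by (auto simp: X'_def intro!: bexI[of _ id])
  have X'K: "X' \<subseteq> K" using X(2) cell_isometriesD(3) by (force simp: X'_def G_def)
  have gX': "g y \<in> X'" if g: "g \<in> G" and y: "y \<in> X'" for g y
  proof -
    obtain h x where h: "h \<in> G" "x \<in> X" "y = h x" using y by (auto simp: X'_def)
    then have "g y = (g \<circ> h) x" by simp
    then show ?thesis using Gc[OF g h(1)] h(2) unfolding X'_def by blast
  qed
  have v0: "0 \<le> v x" for x using X(3)[of x] by (auto simp: v_def less_imp_le)
  have "0 < w' y" if y: "y \<in> X'" for y
  proof -
    obtain h x where h: "h \<in> G" "x \<in> X" "y = h x" using y by (auto simp: X'_def)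
    have "0 < v (inv h y)" using h X(3) by (simp add: v_def invl)
    then have "0 < (\<Sum>g\<in>G. v (g y))" using sum_pos2[OF G(1) Gi[OF h(1)], of "\<lambda>g. v (g y)"] v0 by simp
    then show ?thesis using cG by (simp add: w'_def)
  qed
  moreover have "cell_avg K U = (\<Sum>y\<in>X'. w' y * U y) + W * bdry_avg K U" if U: "U \<in> V" for U
  proof -
    have part: "(\<Sum>y\<in>X'. v (g y) * U y) = cell_avg K U - W * bdry_avg K U" if g: "g \<in> G" for g
    proof -
      have gi: "inv g \<in> cell_isometries K" using Gi[OF g] by (simp add: G_def)
      have UV: "U \<circ> inv g \<in> V" using inv U gi by (auto simp: invariant_space_def)
      have "(\<Sum>y\<in>X'. v (g y) * U y) = (\<Sum>z\<in>X'. v z * U (inv g z))"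
        using g Gi[OF g] by (intro sum.reindex_bij_witness[of _ "inv g" g]) (auto simp: invl invr gX')
      also have "\<dots> = (\<Sum>z\<in>X. v z * U (inv g z))"
        using fX' XX' by (intro sum.mono_neutral_right) (auto simp: v_def)
      also have "\<dots> = (\<Sum>z\<in>X. w z * (U \<circ> inv g) z)" by (simp add: v_def)
      also have "\<dots> = cell_avg K (U \<circ> inv g) - W * bdry_avg K (U \<circ> inv g)" using qU[OF UV] by simp
      finally show ?thesis
        using mesh_cellD(1)[OF cell]
        by (simp add: cell_avg_isometry[OF _ gi V_continuous[OF U]] bdry_avg_isometry[OF _ gi V_continuous[OF U]])
    qed
    have "(\<Sum>y\<in>X'. w' y * U y) = (\<Sum>y\<in>X'. \<Sum>g\<in>G. v (g y) * U y) / card G"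
      by (simp add: w'_def sum_divide_distrib sum_distrib_right)
    also have "(\<Sum>y\<in>X'. \<Sum>g\<in>G. v (g y) * U y) = (\<Sum>g\<in>G. \<Sum>y\<in>X'. v (g y) * U y)"
      by (rule sum.swap)
    also have "\<dots> = card G * (cell_avg K U - W * bdry_avg K U)" by (simp add: part)
    finally show ?thesis using cG by simp
  qed
  ultimately have "quadrature_rule K V X' w' W"
    unfolding quadrature_rule_def using fX' X'K X(4) by blast
  moreover have "invariant_rule K X' w'"
    unfolding invariant_rule_def G_def[symmetric]
  proof (intro ballI conjI)
    fix h assume h: "h \<in> G"
    show "h ` X' = X'"
    proof
      show "h ` X' \<subseteq> X'" using gX'[OF h] by blast
      show "X' \<subseteq> h ` X'"
      proof
        fix y assume "y \<in> X'"
        then show "y \<in> h ` X'" using gX'[OF Gi[OF h]] invr[OF h] by (metis imageI)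
      qed
    qed
    fix y assume "y \<in> X'"
    have "(\<Sum>g\<in>G. v (g (h y))) = (\<Sum>g\<in>G. v (g y))"
      using h Gi[OF h]
      by (intro sum.reindex_bij_witness[of _ "\<lambda>g. g \<circ> inv h" "\<lambda>g. g \<circ> h"])
        (auto simp: Gc fun_eq_iff invl invr)
    then show "w' (h y) = w' y" by (simp add: w'_def)
  qed
  ultimately show ?thesis by blast
qed

end

section \<open>Polynomial spaces and the main result\<close>

lemma sum_scaled_functions:
  "(\<Sum>b\<in>B. (\<lambda>x. c b * b x)) = (\<lambda>x. \<Sum>b\<in>B. c b * (b x :: real))"
  by (induction B rule: infinite_finite_induct) (auto simp: fun_eq_iff)

lemma poly_space_imp_cell_polynomials:
  fixes K :: "(real ^ 'n) set"
  assumes cell: "mesh_cell K" and space: "poly_space V" and one: "(\<lambda>_. 1) \<in> V"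
  shows "\<exists>B. cell_polynomials K V B"
proof -
  obtain B0 where V: "\<And>U. U \<in> V \<Longrightarrow> real_polynomial_function U" "fun_vs.subspace V"
    and B0: "finite B0" "fun_vs.span B0 = V"
    using space unfolding poly_space_def by blast
  obtain B where B: "B \<subseteq> B0" "\<not> fun_vs.dependent B" "B0 \<subseteq> fun_vs.span B"
    using fun_vs.maximal_independent_subset[of B0] by blast
  have fB: "finite B" using B(1) B0(1) by (rule finite_subset)
  have "fun_vs.span B = V"
  proof
    show "fun_vs.span B \<subseteq> V" using fun_vs.span_mono[OF B(1)] B0(2) by simp
    show "V \<subseteq> fun_vs.span B" using fun_vs.span_minimal[OF B(3)] B0(2) by simp
  qed
  then have V_eq: "V = range (\<lambda>c x. \<Sum>b\<in>B. c b * b x)"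
    by (simp add: fun_vs.span_finite[OF fB] sum_scaled_functions)
  have "cell_polynomials K V B"
  proof
    show "mesh_cell K" "finite B" "(\<lambda>_. 1) \<in> V" by (fact cell fB one)+
    show "real_polynomial_function U" if "U \<in> V" for U using that by (rule V(1))
    show "U \<in> V \<longleftrightarrow> (\<exists>c. U = (\<lambda>x. \<Sum>b\<in>B. c b * b x))" for U by (auto simp: V_eq)
    fix c :: "(real ^ 'n \<Rightarrow> real) \<Rightarrow> real" and b
    assume zero: "\<And>x. (\<Sum>b\<in>B. c b * b x) = 0" and b: "b \<in> B"
    have "(\<Sum>b\<in>B. (\<lambda>x. c b * b x)) = 0"
      by (simp add: sum_scaled_functions zero zero_fun_def)
    then show "c b = 0" by (rule fun_vs.independentD[OF B(2) fB subset_refl _ b])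
  qed
  then show ?thesis by blast
qed

lemma one_in_polys_deg_le: "(\<lambda>_. 1) \<in> polys_deg_le k"
  unfolding polys_deg_le_def
  by (rule fun_vs.span_base) (auto intro!: exI[of _ "\<lambda>_. 0"])

theorem corollary5p11:
  fixes K :: "(real ^ 'n) set" and V :: "(real ^ 'n \<Rightarrow> real) set" and k :: nat
  assumes cell: "mesh_cell K"
    and space: "poly_space V"
    and order: "polys_deg_le k \<subseteq> V"
  shows
    \<comment> \<open>(1)\<close>
    "(\<forall>M. Mstar K V \<le> M \<longrightarrow> damping_retains_accuracy K V k M) \<and>
    \<comment> \<open>(2)\<close>
     (\<forall>U\<in>pos_polys K V. \<forall>X w W. quadrature_rule K V X w W \<longrightarrow>
        bdry_ratio K U \<le> Mstar K V \<and> Mstar K V \<le> inverse W) \<and>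
    \<comment> \<open>(3)\<close>
     (\<exists>U X w W. optimizer K V U \<and> quadrature_rule K V X w W \<and>
        bdry_ratio K U = Mstar K V \<and> Mstar K V = inverse W) \<and>
    \<comment> \<open>(4)\<close>
     (\<forall>X w W M. quadrature_rule K V X w W \<and> W = inverse M \<longrightarrow>
        (\<forall>U\<in>V. (\<forall>x\<in>X. 0 \<le> U x) \<longrightarrow> 0 \<le> retentional K M U)) \<and>
    \<comment> \<open>(5)\<close>
     (\<forall>U. optimizer K V U \<longrightarrow>
        (Mstar K V \<noteq> 1 \<longrightarrow> {x\<in>K. U x = 0} \<noteq> {}) \<and>
        (\<forall>X w W. quadrature_rule K V X w W \<and> W = 1 / Mstar K V \<longrightarrow> X \<subseteq> {x\<in>K. U x = 0})) \<and>
    \<comment> \<open>(6) for (2) and (4): invariant rules\<close>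
     (\<forall>U\<in>pos_polys K V. \<forall>X w W. quadrature_rule K V X w W \<and> invariant_rule K X w \<longrightarrow>
        bdry_ratio K U \<le> Mstar K V \<and> Mstar K V \<le> inverse W) \<and>
     (\<forall>X w W M. quadrature_rule K V X w W \<and> invariant_rule K X w \<and> W = inverse M \<longrightarrow>
        (\<forall>U\<in>V. (\<forall>x\<in>X. 0 \<le> U x) \<longrightarrow> 0 \<le> retentional K M U)) \<and>
    \<comment> \<open>(6) for (5): invariant optimizers, respectively invariant rules\<close>
     (\<forall>U. optimizer K V U \<and> invariant_fun K U \<longrightarrow>
        (Mstar K V \<noteq> 1 \<longrightarrow> {x\<in>K. U x = 0} \<noteq> {}) \<and>
        (\<forall>X w W. quadrature_rule K V X w W \<and> W = 1 / Mstar K V \<longrightarrow> X \<subseteq> {x\<in>K. U x = 0})) \<and>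
     (\<forall>U. optimizer K V U \<longrightarrow>
        (\<forall>X w W. quadrature_rule K V X w W \<and> invariant_rule K X w \<and> W = 1 / Mstar K V \<longrightarrow>
           X \<subseteq> {x\<in>K. U x = 0})) \<and>
    \<comment> \<open>(6) for (3): invariant optimizer; invariant optimizer and invariant rule.  The isometries
       act on \<open>V\<close> by composition only if \<open>V\<close> is invariant, and a finite invariant point set
       needs a finite symmetry group (automatic for polytopes, false for balls).\<close>
     (invariant_space K V \<longrightarrow>
        (\<exists>U X w W. optimizer K V U \<and> invariant_fun K U \<and> quadrature_rule K V X w W \<and>
           bdry_ratio K U = Mstar K V \<and> Mstar K V = inverse W)) \<and>
     (invariant_space K V \<and> finite (cell_isometries K) \<longrightarrow>
        (\<exists>U X w W. optimizer K V U \<and> invariant_fun K U \<and>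
           quadrature_rule K V X w W \<and> invariant_rule K X w \<and>
           bdry_ratio K U = Mstar K V \<and> Mstar K V = inverse W))"
proof -
  have "(\<lambda>_. 1) \<in> V" using order one_in_polys_deg_le by blast
  then obtain B where "cell_polynomials K V B"
    using poly_space_imp_cell_polynomials[OF cell space] by blast
  then interpret cell_polynomials K V B .
  have p1: "\<forall>M. Mstar K V \<le> M \<longrightarrow> damping_retains_accuracy K V k M"
    using damping_retains by blast
  have p2: "\<forall>U\<in>pos_polys K V. \<forall>X w W. quadrature_rule K V X w W \<longrightarrow>
      bdry_ratio K U \<le> Mstar K V \<and> Mstar K V \<le> inverse W"
    using bracket by blast
  obtain X w where rule: "quadrature_rule K V X w (inverse (Mstar K V))"
    using optimal_quadrature_exists by blast
  have ratio: "bdry_ratio K U = Mstar K V" if "optimizer K V U" for U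
    using that by (simp add: optimizer_def)
  have p3: "\<exists>U X w W. optimizer K V U \<and> quadrature_rule K V X w W \<and>
      bdry_ratio K U = Mstar K V \<and> Mstar K V = inverse W"
    using optimizer_exists rule ratio inverse_inverse_eq[of "Mstar K V"] by metis
  have p4: "\<forall>X w W M. quadrature_rule K V X w W \<and> W = inverse M \<longrightarrow>
      (\<forall>U\<in>V. (\<forall>x\<in>X. 0 \<le> U x) \<longrightarrow> 0 \<le> retentional K M U)"
    using retentional_nonneg_at_points by blast
  have p5: "\<forall>U. optimizer K V U \<longrightarrow>
      (Mstar K V \<noteq> 1 \<longrightarrow> {x\<in>K. U x = 0} \<noteq> {}) \<and>
      (\<forall>X w W. quadrature_rule K V X w W \<and> W = 1 / Mstar K V \<longrightarrow> X \<subseteq> {x\<in>K. U x = 0})"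
    using optimizer_has_zero optimizer_zero_on_points by blast
  have p6: "\<exists>U X w W. optimizer K V U \<and> invariant_fun K U \<and> quadrature_rule K V X w W \<and>
      bdry_ratio K U = Mstar K V \<and> Mstar K V = inverse W" if "invariant_space K V"
    using invariant_optimizer_exists[OF that] rule ratio inverse_inverse_eq[of "Mstar K V"] by metis
  have p7: "\<exists>U X w W. optimizer K V U \<and> invariant_fun K U \<and>
      quadrature_rule K V X w W \<and> invariant_rule K X w \<and>
      bdry_ratio K U = Mstar K V \<and> Mstar K V = inverse W"
    if "invariant_space K V \<and> finite (cell_isometries K)"
    using invariant_optimizer_exists invariant_rule_exists[OF rule] that ratio
      inverse_inverse_eq[of "Mstar K V"] by metis
  show ?thesis
    by (intro conjI; (rule p1 p2 p3 p4 p5 | (use p2 p4 p5 p6 p7 in blast)))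
qed

end
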